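(* Let the arbitrarily varying channel described in the context be non-symmetrizable. Let $(k_j,n_j)_{j\ge1}$ be a sequence of pairs of positive integers with $k_j\to\infty$, $n_j\to\infty$, such that $\lim_{j\to\infty} k_j/n_j$ exists and satisfies $\lim_{j\to\infty}\frac{k_j}{n_j}>\frac{C}{R(\mathbf{d})}$. Then $$\lim_{j\to\infty}\underline{\nu}(k_j,n_j)=\lim_{j\to\infty}\overline{\nu}(k_j,n_j)=1.$$
   Context: Finite sets $\mathcal{X}$ (channel inputs), $\mathcal{Y}$ (outputs), $\mathcal{T}$ (states), $\mathcal{S}$ (source alphabet). For each $\theta\in\mathcal{T}$, $P_{\mathbb{Y}|\mathbb{X},\Theta}(\cdot|x,\theta)$ is a channel from $\mathcal{X}$ to $\mathcal{Y}$. The channel is memoryless: $P_{Y|X,\Theta}(y|x,\theta)=\prod_{i=1}^n P_{\mathbb{Y}|\mathbb{X},\Theta}(y_i|x_i,\theta_i)$. The AVC is non-symmetrizable if there is no $P_{\Theta|\mathbb{X}}\in\mathcal{P}(\mathcal{T}|\mathcal{X})$ with $\sum_\theta P_{\Theta|\mathbb{X}}(\theta|x)P_{\mathbb{Y}|\mathbb{X},\Theta}(y|x',\theta)=\sum_\theta P_{\Theta|\mathbb{X}}(\theta|x')P_{\mathbb{Y}|\mathbb{X},\Theta}(y|x,\theta)$ for all $x,x',y$. The source $S\in\mathcal{S}^k$ is i.i.d. with fixed law $P_{\mathbb{S}}$. A distortion function $d_{\mathsf S}:\mathcal{S}\times\mathcal{S}\to[0,\infty)$ and level $\mathbf{d}\ge0$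 are fixed; $d(s,\hat s)=\frac1k\sum_{i=1}^k d_{\mathsf S}(s_i,\hat s_i)$. For a stochastic code $Q_{X|S}\in\mathcal{P}(\mathcal{X}^n|\mathcal{S}^k)$, $Q_{\hat S|Y}\in\mathcal{P}(\mathcal{S}^k|\mathcal{Y}^n)$ and jammer distribution $q\in\mathcal{P}(\mathcal{T}^n)$, the error probability is $\mathbb{P}(d(S,\hat S)>\mathbf{d})=\sum_{s,x,y,\hat s,\theta}\mathbb{I}\{d(s,\hat s)>\mathbf{d}\}q(\theta)P_S(s)Q_{X|S}(x|s)P_{Y|X,\Theta}(y|x,\theta)Q_{\hat S|Y}(\hat s|y)$. Upper value: $\overline{\nu}(k,n)=\min_{Q_{X|S},Q_{\hat S|Y}}\max_{q}\mathbb{P}(d(S,\hat S)>\mathbf{d})$; lower value: $\underline{\nu}(k,n)=\max_{q}\min_{Q_{X|S},Q_{\hat S|Y}}\mathbb{P}(d(S,\hat S)>\mathbf{d})$. Capacity: $C=\max_{P_{\mathbb{X}}}\min_{q_\Theta\in\mathcal{P}(\mathcal{T})}I(\mathbb{X};\mathbb{Y}_{q_\Theta})$, where $\mathbb{Y}_{q_\Theta}$ is the output of the averaged channel $\sum_\theta q_\Theta(\theta)P_{\mathbb{Y}|\mathbb{X},\Theta=\theta}$ with input $\mathbb{X}\sim P_{\mathbb{X}}$. Rate-distortion function: $R(\mathbf{d})=\min_{P_{\hat{\mathbb S}|\mathbb S}:\mathbb{E}[d_{\mathsf S}(\mathbb S,\hat{\mathbb S})]\le\mathbf d}I(\mathbb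 S;\hat{\mathbb S})$. Logarithms are base 2. *)

theory Defs
  imports "HOL-Analysis.Analysis"
begin

definition distr_on :: "'a set \<Rightarrow> ('a \<Rightarrow> real) set" where
  "distr_on A = {p. (\<forall>a. 0 \<le> p a) \<and> (\<forall>a. a \<notin> A \<longrightarrow> p a = 0) \<and> sum p A = 1}"

definition kernel_on :: "'a set \<Rightarrow> 'b set \<Rightarrow> ('a \<Rightarrow> 'b \<Rightarrow> real) set" where
  "kernel_on A B = {Q. \<forall>a\<in>A. Q a \<in> distr_on B}"

definition words :: "nat \<Rightarrow> 'a list set" where
  "words n = {xs. length xs = n}"

text \<open>Single-letter channel W x theta y = P(y | x, theta); memoryless extension.\<close>
definition chan_n :: "('x \<Rightarrow> 't \<Rightarrow> 'y \<Rightarrow> real) \<Rightarrow> 'x list \<Rightarrow> 't list \<Rightarrow> 'y list \<Rightarrow> real" where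
  "chan_n W x th y = (\<Prod>i<length x. W (x ! i) (th ! i) (y ! i))"

definition src_k :: "('s \<Rightarrow> real) \<Rightarrow> 's list \<Rightarrow> real" where
  "src_k PS s = (\<Prod>i<length s. PS (s ! i))"

definition dist_k :: "('s \<Rightarrow> 's \<Rightarrow> real) \<Rightarrow> 's list \<Rightarrow> 's list \<Rightarrow> real" where
  "dist_k dS s sh = (1 / real (length s)) * (\<Sum>i<length s. dS (s ! i) (sh ! i))"

definition err_prob ::
  "('s::finite \<Rightarrow> real) \<Rightarrow> ('x::finite \<Rightarrow> 't::finite \<Rightarrow> 'y::finite \<Rightarrow> real) \<Rightarrow> ('s \<Rightarrow> 's \<Rightarrow> real) \<Rightarrow> real
    \<Rightarrow> nat \<Rightarrow> nat \<Rightarrow> ('s list \<Rightarrow> 'x list \<Rightarrow> real) \<Rightarrow> ('y list \<Rightarrow> 's list \<Rightarrow> real) \<Rightarrow> ('t list \<Rightarrow> real) \<Rightarrow> real" where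
  "err_prob PS W dS dl k n QX QS q =
     (\<Sum>s\<in>words k. \<Sum>x\<in>words n. \<Sum>y\<in>words n. \<Sum>sh\<in>words k. \<Sum>th\<in>words n.
        (if dist_k dS s sh > dl then 1 else 0) * q th * src_k PS s * QX s x * chan_n W x th y * QS y sh)"

definition codes :: "nat \<Rightarrow> nat \<Rightarrow> (('s::finite list \<Rightarrow> 'x::finite list \<Rightarrow> real) \<times> ('y::finite list \<Rightarrow> 's list \<Rightarrow> real)) set" where
  "codes k n = kernel_on (words k) (words n) \<times> kernel_on (words n) (words k)"

definition upper_val ::
  "('s::finite \<Rightarrow> real) \<Rightarrow> ('x::finite \<Rightarrow> 't::finite \<Rightarrow> 'y::finite \<Rightarrow> real) \<Rightarrow> ('s \<Rightarrow> 's \<Rightarrow> real) \<Rightarrow> real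
    \<Rightarrow> nat \<Rightarrow> nat \<Rightarrow> real" where
  "upper_val PS W dS dl k n =
     Inf ((\<lambda>(QX, QS). Sup ((\<lambda>q. err_prob PS W dS dl k n QX QS q) ` distr_on (words n))) ` codes k n)"

definition lower_val ::
  "('s::finite \<Rightarrow> real) \<Rightarrow> ('x::finite \<Rightarrow> 't::finite \<Rightarrow> 'y::finite \<Rightarrow> real) \<Rightarrow> ('s \<Rightarrow> 's \<Rightarrow> real) \<Rightarrow> real
    \<Rightarrow> nat \<Rightarrow> nat \<Rightarrow> real" where
  "lower_val PS W dS dl k n =
     Sup ((\<lambda>q. Inf ((\<lambda>(QX, QS). err_prob PS W dS dl k n QX QS q) ` codes k n)) ` distr_on (words n))"

definition mutual_info :: "('a::finite \<Rightarrow> real) \<Rightarrow> ('a \<Rightarrow> 'b::finite \<Rightarrow> real) \<Rightarrow> real" where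
  "mutual_info P V = (\<Sum>a\<in>UNIV. \<Sum>b\<in>UNIV.
     (if P a * V a b = 0 then 0
      else P a * V a b * log 2 (V a b / (\<Sum>a'\<in>UNIV. P a' * V a' b))))"

definition avg_chan :: "('x \<Rightarrow> 't::finite \<Rightarrow> 'y \<Rightarrow> real) \<Rightarrow> ('t \<Rightarrow> real) \<Rightarrow> 'x \<Rightarrow> 'y \<Rightarrow> real" where
  "avg_chan W q x y = (\<Sum>th\<in>UNIV. q th * W x th y)"

definition capacity :: "('x::finite \<Rightarrow> 't::finite \<Rightarrow> 'y::finite \<Rightarrow> real) \<Rightarrow> real" where
  "capacity W = Sup ((\<lambda>P. Inf ((\<lambda>q. mutual_info P (avg_chan W q)) ` distr_on UNIV)) ` distr_on UNIV)"

definition rate_distortion :: "('s::finite \<Rightarrow> real) \<Rightarrow> ('s \<Rightarrow> 's \<Rightarrow> real) \<Rightarrow> real \<Rightarrow> real" where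
  "rate_distortion PS dS dl = Inf ((\<lambda>V. mutual_info PS V) `
      {V \<in> kernel_on UNIV UNIV. (\<Sum>s\<in>UNIV. \<Sum>sh\<in>UNIV. PS s * V s sh * dS s sh) \<le> dl})"

definition symmetrizable :: "('x::finite \<Rightarrow> 't::finite \<Rightarrow> 'y::finite \<Rightarrow> real) \<Rightarrow> bool" where
  "symmetrizable W = (\<exists>U \<in> kernel_on (UNIV::'x set) (UNIV::'t set).
     \<forall>x x' y. (\<Sum>th\<in>UNIV. U x th * W x' th y) = (\<Sum>th\<in>UNIV. U x' th * W x th y))"

end

theory Submission
  imports Defs
begin

text \<open>The jammer plays i.i.d. with a single-letter law \<open>q\<close>, which turns the AVC into the memoryless channel
  \<open>V = avg_chan W q\<close>. By a minimax argument \<open>q\<close> and an output law \<open>r\<close> can be chosen such that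
  \<open>D (V x \<parallel> r)\<close> exceeds \<open>C\<close> by arbitrarily little for \<^emph>\<open>every\<close> input letter \<open>x\<close>. Convex duality for the
  rate-distortion problem gives a tilted information \<open>j\<close> with mean above any \<open>R0 < R(d)\<close> such that every fixed
  reproduction word covers a source word of tilted information at least \<open>k R0\<close> with probability at most
  \<open>2 powr (- k R0)\<close>. Replacing the channel output law by the product law of \<open>r\<close> costs a factor of at most
  \<open>2 powr (n (C + \<delta>))\<close> outside a large-deviation event, so the probability of success is at most
  \<open>2 powr (n (C + \<delta>) - k R0)\<close> plus two exponentially small Chernoff terms, uniformly over all codes.\<close>

section \<open>Words and finite distributions\<close>

lemma finite_words [simp]: "finite (words n :: 'a::finite list set)"
  using finite_lists_length_eq[of "UNIV :: 'a set" n] by (simp add: words_def)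

lemma words_0: "words 0 = {[]}"
  by (auto simp: words_def)

lemma words_Suc: "words (Suc n) = (\<lambda>(a, w). a # w) ` (UNIV \<times> words n)"
  by (auto simp: words_def length_Suc_conv image_iff)

text \<open>The distributive law, by peeling off the first letter. Through it every total mass and
  every exponential moment over words reduces to single-letter sums.\<close>

lemma sum_words_prod:
  fixes f :: "nat \<Rightarrow> 'a::finite \<Rightarrow> real"
  shows "(\<Sum>w\<in>words n. \<Prod>i<n. f i (w ! i)) = (\<Prod>i<n. \<Sum>a\<in>UNIV. f i a)"
proof (induction n arbitrary: f)
  case 0
  show ?case by (simp add: words_0)
next
  case (Suc n)
  have "(\<Sum>w\<in>words (Suc n). \<Prod>i<Suc n. f i (w ! i))
      = (\<Sum>p\<in>UNIV \<times> words n. f 0 (fst p) * (\<Prod>i<n. f (Suc i) (snd p ! i)))"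
    unfolding words_Suc
    by (subst sum.reindex)
      (auto simp: inj_on_def case_prod_beta prod.lessThan_Suc_shift simp del: prod.lessThan_Suc)
  also have "\<dots> = (\<Sum>a\<in>UNIV. \<Sum>w\<in>words n. f 0 a * (\<Prod>i<n. f (Suc i) (w ! i)))"
    by (simp add: sum.cartesian_product case_prod_beta)
  also have "\<dots> = (\<Sum>a\<in>UNIV. f 0 a) * (\<Sum>w\<in>words n. \<Prod>i<n. f (Suc i) (w ! i))"
    by (simp add: sum_product)
  also have "\<dots> = (\<Prod>i<Suc n. \<Sum>a\<in>UNIV. f i a)"
    by (simp add: Suc.IH[of "\<lambda>i. f (Suc i)"] prod.lessThan_Suc_shift del: prod.lessThan_Suc)
  finally show ?case .
qed

lemma sum_words_prod_le_power:
  fixes f :: "nat \<Rightarrow> 'a::finite \<Rightarrow> real"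
  assumes "\<And>i a. 0 \<le> f i a" "\<And>i. i < n \<Longrightarrow> (\<Sum>a\<in>UNIV. f i a) \<le> c"
  shows "(\<Sum>w\<in>words n. \<Prod>i<n. f i (w ! i)) \<le> c ^ n"
proof -
  have "(\<Prod>i<n. \<Sum>a\<in>UNIV. f i a) \<le> (\<Prod>i<n. c)"
    using assms by (intro prod_mono) (auto intro: sum_nonneg)
  then show ?thesis by (simp add: sum_words_prod)
qed

lemma distr_onD:
  assumes "p \<in> distr_on A"
  shows "0 \<le> p a" "a \<notin> A \<Longrightarrow> p a = 0" "sum p A = 1"
  using assms by (auto simp: distr_on_def)

lemma distr_on_uniform: "(\<lambda>_. 1 / real CARD('a)) \<in> distr_on (UNIV :: 'a::finite set)"
  by (simp add: distr_on_def)

text \<open>At \<open>t = 0\<close> the moment has value 1 and its derivative is the mean of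
  \<open>c\<close>, so a negative mean pushes it below 1 just to the right. This is the Chernoff
  step behind both error exponents.\<close>

lemma exp_moment_less_1:
  fixes p c :: "'a::finite \<Rightarrow> real"
  assumes p: "p \<in> distr_on UNIV" and neg: "(\<Sum>a\<in>UNIV. p a * c a) < 0"
  shows "eventually (\<lambda>t. (\<Sum>a\<in>UNIV. p a * exp (t * c a)) < 1) (at_right 0)"
proof -
  have "((\<lambda>t. \<Sum>a\<in>UNIV. p a * exp (t * c a)) has_real_derivative (\<Sum>a\<in>UNIV. p a * c a)) (at 0)"
    by (auto intro!: derivative_eq_intros sum.cong)
  from DERIV_neg_dec_right[OF this neg] obtain d where "d > 0"
    and "\<And>h. 0 < h \<Longrightarrow> h < d \<Longrightarrow> (\<Sum>a\<in>UNIV. p a * exp (h * c a)) < 1"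
    using distr_onD(3)[OF p] by auto
  then show ?thesis by (auto simp: eventually_at_right_field)
qed

section \<open>Divergence and mutual information\<close>

text \<open>The tangent of \<open>w \<mapsto> w ln (w / r)\<close> at \<open>w = c r\<close>.\<close>
lemma mult_ln_div_ge:
  fixes w r c :: real
  assumes "0 \<le> w" "0 \<le> r" "r = 0 \<longrightarrow> w = 0" "0 < c"
  shows "w * ln c + w - c * r \<le> w * ln (w / r)"
proof (cases "w = 0")
  case True
  then show ?thesis using assms by simp
next
  case False
  then have "w > 0" "r > 0" using assms by auto
  then have "ln (c * r / w) \<le> c * r / w - 1"
    using \<open>0 < c\<close> by (intro ln_le_minus_one) auto
  then have "w * ln (c * r / w) \<le> w * (c * r / w - 1)"
    using \<open>w > 0\<close> by simp
  moreover have "ln (c * r / w) = ln c - ln (w / r)"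
    using \<open>w > 0\<close> \<open>r > 0\<close> \<open>0 < c\<close> by (simp add: ln_mult ln_div)
  ultimately show ?thesis using \<open>w > 0\<close> by (simp add: algebra_simps)
qed

text \<open>Both summands are bounded below by tangents with the same \<open>c\<close>, the ratio of
  the totals; the linear remainders of the two tangents then cancel.\<close>

lemma log_sum_ineq:
  fixes w1 w2 r1 r2 :: real
  assumes "0 \<le> w1" "0 \<le> r1" "r1 = 0 \<longrightarrow> w1 = 0" "0 \<le> w2" "0 \<le> r2" "r2 = 0 \<longrightarrow> w2 = 0"
  shows "(w1 + w2) * ln ((w1 + w2) / (r1 + r2)) \<le> w1 * ln (w1 / r1) + w2 * ln (w2 / r2)"
proof (cases "w1 + w2 = 0")
  case True
  then have "w1 = 0" "w2 = 0" using assms by auto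
  then show ?thesis by simp
next
  case False
  then have "w1 + w2 > 0" "r1 + r2 > 0" using assms by linarith+
  define c where "c = (w1 + w2) / (r1 + r2)"
  have "c > 0" using \<open>w1 + w2 > 0\<close> \<open>r1 + r2 > 0\<close> by (simp add: c_def)
  have "c * (r1 + r2) = w1 + w2"
    using \<open>r1 + r2 > 0\<close> by (simp add: c_def)
  then show ?thesis
    using mult_ln_div_ge[of w1 r1 c] mult_ln_div_ge[of w2 r2 c] assms \<open>c > 0\<close>
    by (simp add: c_def[symmetric] algebra_simps)
qed

text \<open>The function is homogeneous of degree one, so its subadditivity in
  \<open>log_sum_ineq\<close> already amounts to joint convexity.\<close>

lemma mult_ln_div_convex:
  fixes w1 w2 r1 r2 u v :: real
  assumes "0 \<le> w1" "0 \<le> r1" "r1 = 0 \<longrightarrow> w1 = 0" "0 \<le> w2" "0 \<le> r2" "r2 = 0 \<longrightarrow> w2 = 0"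
    and "0 \<le> u" "0 \<le> v"
  shows "(u * w1 + v * w2) * ln ((u * w1 + v * w2) / (u * r1 + v * r2))
    \<le> u * (w1 * ln (w1 / r1)) + v * (w2 * ln (w2 / r2))"
proof -
  have *: "(t * w) * ln ((t * w) / (t * r)) = t * (w * ln (w / r))" for t w r :: real
    by (cases "t = 0") auto
  show ?thesis
    using log_sum_ineq[of "u * w1" "u * r1" "v * w2" "v * r2"] assms unfolding * by auto
qed

lemma mutual_info_ln:
  "mutual_info P V * ln 2 = (\<Sum>a\<in>UNIV. \<Sum>b\<in>UNIV. P a * (V a b * ln (V a b / (\<Sum>a'\<in>UNIV. P a' * V a' b))))"
  unfolding mutual_info_def sum_distrib_right
  by (intro sum.cong refl) (simp add: log_def)

text \<open>Crude bounds that keep infima and suprema of mutual information well behaved. The lower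
  one is the tangent at \<open>c = 1\<close>; the upper one combines \<open>ln x \<le> x\<close>
  with the fact that \<open>P a * V a b\<close> is at most the output mass.\<close>

lemma mutual_info_bounds:
  fixes P :: "'a::finite \<Rightarrow> real" and V :: "'a \<Rightarrow> 'b::finite \<Rightarrow> real"
  assumes P: "P \<in> distr_on UNIV" and V: "V \<in> kernel_on UNIV UNIV"
  shows "0 \<le> mutual_info P V" "mutual_info P V * ln 2 \<le> real CARD('a)"
proof -
  define out where "out b = (\<Sum>a\<in>UNIV. P a * V a b)" for b
  have nn: "0 \<le> P a" "0 \<le> V a b" and sums: "sum P UNIV = 1" "sum (V a) UNIV = 1" for a b
    using P V by (auto simp: kernel_on_def distr_on_def)
  have out_ge: "P a * V a b \<le> out b" for a b
    unfolding out_def by (rule member_le_sum) (auto simp: nn)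
  have out_nn: "0 \<le> out b" for b
    unfolding out_def by (intro sum_nonneg) (simp add: nn)
  have V_zero: "V a b = 0" if "P a > 0" "out b = 0" for a b
    using out_ge[of a b] that nn(2)[of a b] by (simp add: mult_le_0_iff)
  have sum_out: "sum out UNIV = 1"
    unfolding out_def by (subst sum.swap) (simp add: sum_distrib_left[symmetric] sums)
  have lower: "P a * V a b - P a * out b \<le> P a * (V a b * ln (V a b / out b))" for a b
  proof (cases "P a = 0")
    case False
    then have "P a > 0" using nn[of a] by (simp add: less_le)
    then have "V a b - out b \<le> V a b * ln (V a b / out b)"
      using mult_ln_div_ge[of "V a b" "out b" 1] nn out_nn V_zero by auto
    then show ?thesis
      using \<open>P a > 0\<close> by (simp add: right_diff_distrib[symmetric])
  qed simp
  have upper: "P a * (V a b * ln (V a b / out b)) \<le> V a b" for a b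
  proof (cases "P a * V a b = 0")
    case False
    then have pos: "P a > 0" "V a b > 0" using nn by (auto simp: less_le)
    then have "out b > 0" using out_ge[of a b] mult_pos_pos[of "P a" "V a b"] by linarith
    have "P a * V a b * ln (V a b / out b) \<le> P a * V a b * (V a b / out b)"
      using pos \<open>out b > 0\<close> ln_le_minus_one[of "V a b / out b"] by (intro mult_left_mono) auto
    also have "\<dots> = V a b * (P a * V a b / out b)" by simp
    also have "\<dots> \<le> V a b * 1"
      using pos \<open>out b > 0\<close> out_ge[of a b] by (intro mult_left_mono) auto
    finally show ?thesis by (simp add: mult.assoc)
  qed (auto simp: nn)
  have "0 = (\<Sum>a\<in>UNIV. \<Sum>b\<in>UNIV. P a * V a b - P a * out b)"
    by (simp add: sum_subtractf sum_distrib_left[symmetric] sums sum_out)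
  also have "\<dots> \<le> mutual_info P V * ln 2"
    unfolding mutual_info_ln out_def[symmetric] by (intro sum_mono lower)
  finally show "0 \<le> mutual_info P V" by (simp add: zero_le_mult_iff)
  have "mutual_info P V * ln 2 \<le> (\<Sum>a\<in>UNIV. \<Sum>b\<in>UNIV. V a b)"
    unfolding mutual_info_ln out_def[symmetric] by (intro sum_mono upper)
  also have "\<dots> = real CARD('a)" by (simp add: sums)
  finally show "mutual_info P V * ln 2 \<le> real CARD('a)" .
qed

text \<open>Payoff vectors are separated from an open orthant; the normal of the hyperplane,
  normalised, is the mixed strategy \<open>P\<close>. Asking only for a dominating \<open>z\<close>
  instead of a convex combination spares \<open>Z\<close> any linear structure.\<close>

lemma finite_minimax:
  fixes f :: "'x::finite \<Rightarrow> 'z \<Rightarrow> real"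
  assumes convexlike: "\<And>z1 z2 u v. \<lbrakk>z1 \<in> Z; z2 \<in> Z; 0 \<le> u; 0 \<le> v; u + v = 1\<rbrakk>
      \<Longrightarrow> \<exists>z\<in>Z. \<forall>x. f x z \<le> u * f x z1 + v * f x z2"
    and ge: "\<And>z. z \<in> Z \<Longrightarrow> \<exists>x. c \<le> f x z"
  shows "\<exists>P\<in>distr_on UNIV. \<forall>z\<in>Z. c \<le> (\<Sum>x\<in>UNIV. P x * f x z)"
proof (cases "Z = {}")
  case True
  then show ?thesis using distr_on_uniform by blast
next
  case False
  \<comment> \<open>Closing the payoff vectors upwards turns the domination hypothesis into genuine
    convexity; \<open>ge\<close> keeps the result disjoint from the open orthant
    \<open>B\<close>.\<close>
  define A where "A = {u :: real^'x. \<exists>z\<in>Z. \<forall>x. f x z \<le> u $ x}"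
  define B where "B = {u :: real^'x. \<forall>x. u $ x < c}"
  have fA: "(\<chi> x. f x z) \<in> A" if "z \<in> Z" for z
    using that by (auto simp: A_def)
  have "convex A"
  proof (rule convexI)
    fix a b and u v :: real
    assume "a \<in> A" "b \<in> A" and uv: "0 \<le> u" "0 \<le> v" "u + v = 1"
    then obtain z1 z2 where z: "z1 \<in> Z" "z2 \<in> Z" "\<And>x. f x z1 \<le> a $ x" "\<And>x. f x z2 \<le> b $ x"
      by (auto simp: A_def)
    obtain z where "z \<in> Z" "\<And>x. f x z \<le> u * f x z1 + v * f x z2"
      using convexlike[OF z(1,2) uv] by auto
    moreover have "u * f x z1 + v * f x z2 \<le> u * a $ x + v * b $ x" for x
      using z uv by (intro add_mono mult_left_mono) auto
    ultimately show "u *\<^sub>R a + v *\<^sub>R b \<in> A"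
      unfolding A_def by (auto intro!: bexI[of _ z] intro: order_trans)
  qed
  moreover have "convex B"
  proof (rule convexI)
    fix a b and u v :: real
    assume ab: "a \<in> B" "b \<in> B" and uv: "0 \<le> u" "0 \<le> v" "u + v = 1"
    have "u * a $ x + v * b $ x < c" for x
      using ab uv convex_bound_lt[of "a $ x" c "b $ x" u v] by (auto simp: B_def)
    then show "u *\<^sub>R a + v *\<^sub>R b \<in> B" by (simp add: B_def)
  qed
  moreover have "A \<noteq> {}" using False fA by blast
  moreover have "(\<chi> x. c - 1) \<in> B" by (simp add: B_def)
  then have "B \<noteq> {}" by blast
  moreover have "B \<inter> A = {}"
    using ge by (auto simp: A_def B_def) (meson not_le order_trans)
  ultimately obtain a b where a: "a \<noteq> 0" and aB: "\<And>v. v \<in> B \<Longrightarrow> a \<bullet> v \<le> b"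
    and aA: "\<And>v. v \<in> A \<Longrightarrow> b \<le> a \<bullet> v"
    using separating_hyperplane_sets[of B A] by metis
  have a_nn: "0 \<le> a $ x" for x
  proof (rule ccontr)
    assume "\<not> 0 \<le> a $ x"
    then have neg: "a $ x < 0" by simp
    \<comment> \<open>Moving down by \<open>t\<close> along coordinate \<open>x\<close> stays in
      \<open>B\<close>, and this size of \<open>t\<close> lifts the linear functional above
      \<open>b\<close>.\<close>
    define t where "t = (\<bar>b\<bar> + \<bar>a \<bullet> (\<chi> x. c - 1)\<bar> + 1) / (- (a $ x))"
    have "t > 0" unfolding t_def using neg by (intro divide_pos_pos) auto
    have "(\<chi> x. c - 1) - axis x t \<in> B"
      using \<open>t > 0\<close> by (auto simp: B_def axis_def)
    then have "a \<bullet> (\<chi> x. c - 1) - a $ x * t \<le> b"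
      using aB by (fastforce simp: inner_diff_right inner_axis)
    moreover have "a $ x * t = - (\<bar>b\<bar> + \<bar>a \<bullet> (\<chi> x. c - 1)\<bar> + 1)"
      using neg by (simp add: t_def field_simps)
    ultimately show False by linarith
  qed
  define s where "s = (\<Sum>x\<in>UNIV. a $ x)"
  have "s \<noteq> 0"
    using a a_nn by (auto simp: s_def sum_nonneg_eq_0_iff vec_eq_iff)
  then have "s > 0" using a_nn by (simp add: s_def less_le sum_nonneg)
  \<comment> \<open>The constant vector \<open>c\<close> is only on the boundary of
    \<open>B\<close>, so it is approached by \<open>c - e / s\<close>, where the loss is exactly
    \<open>e\<close>.\<close>
  have "c * s \<le> b"
  proof (rule field_le_epsilon)
    fix e :: real assume "e > 0"
    have "(\<chi> x. c - e / s) \<in> B" using \<open>e > 0\<close> \<open>s > 0\<close> by (simp add: B_def)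
    then have "(\<Sum>x\<in>UNIV. a $ x * (c - e / s)) \<le> b"
      using aB by (fastforce simp: inner_vec_def)
    then have "s * (c - e / s) \<le> b" by (simp add: s_def sum_distrib_right)
    moreover have "s * (c - e / s) = c * s - e" using \<open>s > 0\<close> by (simp add: right_diff_distrib)
    ultimately show "c * s \<le> b + e" by linarith
  qed
  show ?thesis
  proof (intro bexI ballI)
    show "(\<lambda>x. a $ x / s) \<in> distr_on UNIV"
      using a_nn \<open>s > 0\<close> by (auto simp: distr_on_def sum_divide_distrib[symmetric] s_def[symmetric])
    fix z assume "z \<in> Z"
    then have "c * s \<le> (\<Sum>x\<in>UNIV. a $ x * f x z)"
      using aA[OF fA] \<open>c * s \<le> b\<close> by (fastforce simp: inner_vec_def)
    then show "c \<le> (\<Sum>x\<in>UNIV. a $ x / s * f x z)"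
      using \<open>s > 0\<close> by (simp add: sum_divide_distrib[symmetric] pos_le_divide_eq)
  qed
qed

section \<open>The channel\<close>

lemma avg_chan_kernel:
  assumes W: "\<And>x th. W x th \<in> distr_on UNIV" and q: "q \<in> distr_on UNIV"
  shows "avg_chan W q \<in> kernel_on UNIV UNIV"
proof -
  have "(\<Sum>y\<in>UNIV. avg_chan W q x y) = 1" for x
    unfolding avg_chan_def
    by (subst sum.swap) (simp add: sum_distrib_left[symmetric] distr_onD(3)[OF W] distr_onD(3)[OF q])
  then show ?thesis
    by (auto simp: kernel_on_def distr_on_def avg_chan_def distr_onD(1)[OF W] distr_onD(1)[OF q]
        intro!: sum_nonneg)
qed

text \<open>The supremum defining \<open>capacity\<close> has to be bounded: each inner infimum is
  at most the mutual information under the uniform jammer.\<close>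

lemma Inf_mutual_info_le_capacity:
  fixes W :: "'x::finite \<Rightarrow> 't::finite \<Rightarrow> 'y::finite \<Rightarrow> real"
  assumes W: "\<And>x th. W x th \<in> distr_on UNIV" and P: "P \<in> distr_on UNIV"
  shows "Inf ((\<lambda>q. mutual_info P (avg_chan W q)) ` distr_on UNIV) \<le> capacity W"
proof -
  note MI = mutual_info_bounds[OF _ avg_chan_kernel[OF W]]
  let ?I = "\<lambda>P. Inf ((\<lambda>q. mutual_info P (avg_chan W q)) ` distr_on UNIV)"
  have "?I P \<le> real CARD('x) / ln 2" if "P \<in> distr_on UNIV" for P
  proof -
    have "?I P \<le> mutual_info P (avg_chan W (\<lambda>_. 1 / real CARD('t)))"
      using MI(1)[OF that] distr_on_uniform by (intro cINF_lower bdd_belowI2) auto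
    also have "\<dots> \<le> real CARD('x) / ln 2"
      using MI(2)[OF that distr_on_uniform] by (simp add: pos_le_divide_eq)
    finally show ?thesis .
  qed
  then show ?thesis
    unfolding capacity_def using P by (intro cSUP_upper bdd_aboveI2) auto
qed

lemma capacity_nonneg:
  fixes W :: "'x::finite \<Rightarrow> 't::finite \<Rightarrow> 'y::finite \<Rightarrow> real"
  assumes W: "\<And>x th. W x th \<in> distr_on UNIV"
  shows "0 \<le> capacity W"
proof -
  have "0 \<le> Inf ((\<lambda>q. mutual_info (\<lambda>_. 1 / real CARD('x)) (avg_chan W q)) ` distr_on UNIV)"
    using mutual_info_bounds(1)[OF distr_on_uniform avg_chan_kernel[OF W]] distr_on_uniform
    by (intro cINF_greatest) auto
  then show ?thesis
    using Inf_mutual_info_le_capacity[of W, OF W distr_on_uniform] by linarith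
qed

text \<open>The divergence \<open>D (V x \<parallel> r)\<close> is finite and jointly convex in the jammer law and \<open>r\<close> as long as
  \<open>r\<close> is positive; mixing the true output law with the uniform one loses only \<open>- ln (1 - e)\<close>.\<close>
lemma capacity_divergence_center:
  fixes W :: "'x::finite \<Rightarrow> 't::finite \<Rightarrow> 'y::finite \<Rightarrow> real"
  assumes W: "\<And>x th. W x th \<in> distr_on UNIV" and a: "capacity W * ln 2 < a"
  shows "\<exists>q\<in>distr_on UNIV. \<exists>r\<in>distr_on UNIV. (\<forall>y. 0 < r y) \<and>
    (\<forall>x. (\<Sum>y\<in>UNIV. avg_chan W q x y * ln (avg_chan W q x y / r y)) < a)"
proof (rule ccontr)
  \<comment> \<open>If every pair \<open>(q, r)\<close> left some letter with divergence at least
    \<open>a\<close>, minimax would yield one input law \<open>P\<close> whose mean divergence is at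
    least \<open>a\<close> for all pairs. Letting \<open>r\<close> approach the output law of
    \<open>P\<close> then makes the mutual information at least \<open>a / ln 2\<close> for every
    \<open>q\<close>, against the definition of capacity.\<close>
  assume contra: "\<not> ?thesis"
  define Z where "Z = distr_on (UNIV :: 't set) \<times> {r \<in> distr_on (UNIV :: 'y set). \<forall>y. 0 < r y}"
  define f where "f x z = (\<Sum>y\<in>UNIV. avg_chan W (fst z) x y * ln (avg_chan W (fst z) x y / snd z y))"
    for x and z :: "('t \<Rightarrow> real) \<times> ('y \<Rightarrow> real)"
  have avg_nn: "0 \<le> avg_chan W q x y" if "q \<in> distr_on UNIV" for q x y
    using avg_chan_kernel[of W, OF W that] by (auto simp: kernel_on_def distr_on_def)
  have "\<exists>P\<in>distr_on UNIV. \<forall>z\<in>Z. a \<le> (\<Sum>x\<in>UNIV. P x * f x z)"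
  proof (rule finite_minimax)
    fix z1 z2 and u v :: real
    assume z: "z1 \<in> Z" "z2 \<in> Z" and uv: "0 \<le> u" "0 \<le> v" "u + v = 1"
    define z where "z = (\<lambda>t. u * fst z1 t + v * fst z2 t, \<lambda>y. u * snd z1 y + v * snd z2 y)"
    have pos: "0 < u * snd z1 y + v * snd z2 y" for y
    proof (cases "u = 0")
      case False
      then have "0 < u * snd z1 y" "0 \<le> v * snd z2 y"
        using z uv by (auto simp: Z_def distr_on_def)
      then show ?thesis by linarith
    qed (use z uv in \<open>auto simp: Z_def\<close>)
    have "z \<in> Z"
      using z uv pos
      by (auto simp: Z_def z_def distr_on_def sum.distrib sum_distrib_left[symmetric])
    moreover have "f x z \<le> u * f x z1 + v * f x z2" for x
    proof -
      have "avg_chan W (fst z) x y = u * avg_chan W (fst z1) x y + v * avg_chan W (fst z2) x y" for y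
        by (simp add: avg_chan_def z_def sum.distrib sum_distrib_left algebra_simps)
      then have "f x z = (\<Sum>y\<in>UNIV. (u * avg_chan W (fst z1) x y + v * avg_chan W (fst z2) x y) *
          ln ((u * avg_chan W (fst z1) x y + v * avg_chan W (fst z2) x y) / (u * snd z1 y + v * snd z2 y)))"
        by (simp add: f_def z_def)
      also have "\<dots> \<le> (\<Sum>y\<in>UNIV. u * (avg_chan W (fst z1) x y * ln (avg_chan W (fst z1) x y / snd z1 y))
          + v * (avg_chan W (fst z2) x y * ln (avg_chan W (fst z2) x y / snd z2 y)))"
        using z uv
        by (intro sum_mono mult_ln_div_convex) (auto simp: Z_def avg_nn less_imp_le less_imp_neq[symmetric])
      also have "\<dots> = u * f x z1 + v * f x z2"
        by (simp add: f_def sum.distrib sum_distrib_left)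
      finally show ?thesis .
    qed
    ultimately show "\<exists>z\<in>Z. \<forall>x. f x z \<le> u * f x z1 + v * f x z2" by blast
  next
    fix z assume "z \<in> Z"
    then have "fst z \<in> distr_on UNIV" "snd z \<in> distr_on UNIV" "\<forall>y. 0 < snd z y"
      by (auto simp: Z_def)
    then have "\<not> (\<forall>x. f x z < a)"
      using contra unfolding f_def by blast
    then show "\<exists>x. a \<le> f x z" by (simp add: not_less)
  qed
  then obtain P where P: "P \<in> distr_on UNIV" and Pf: "\<And>z. z \<in> Z \<Longrightarrow> a \<le> (\<Sum>x\<in>UNIV. P x * f x z)"
    by blast
  have "a / ln 2 \<le> mutual_info P (avg_chan W q)" if q: "q \<in> distr_on UNIV" for q
  proof -
    define V where "V = avg_chan W q"
    define out where "out y = (\<Sum>x\<in>UNIV. P x * V x y)" for y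
    have nn: "0 \<le> P x" "0 \<le> V x y" and sums: "sum P UNIV = 1" "sum (V x) UNIV = 1" for x y
      using P avg_chan_kernel[of W, OF W q] by (auto simp: V_def kernel_on_def distr_on_def)
    have out_ge: "P x * V x y \<le> out y" for x y
      unfolding out_def by (rule member_le_sum) (auto simp: nn)
    have out_nn: "0 \<le> out y" for y
      unfolding out_def by (intro sum_nonneg) (simp add: nn)
    have sum_out: "sum out UNIV = 1"
      unfolding out_def by (subst sum.swap) (simp add: sum_distrib_left[symmetric] sums)
    have bound: "a + ln (1 - e) \<le> mutual_info P V * ln 2" if e: "0 < e" "e < 1" for e
    proof -
      define r where "r y = (1 - e) * out y + e / real CARD('y)" for y
      have r_pos: "0 < r y" for y
        using e out_nn[of y] by (auto simp: r_def intro!: add_nonneg_pos)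
      have "r \<in> distr_on UNIV"
        using r_pos by (auto simp: distr_on_def less_imp_le)
          (simp add: r_def sum.distrib sum_distrib_left[symmetric] sum_out)
      then have "a \<le> (\<Sum>x\<in>UNIV. P x * f x (q, r))"
        using q r_pos by (intro Pf) (auto simp: Z_def)
      also have "\<dots> = (\<Sum>x\<in>UNIV. \<Sum>y\<in>UNIV. P x * (V x y * ln (V x y / r y)))"
        by (simp add: f_def V_def sum_distrib_left)
      also have "\<dots> \<le> (\<Sum>x\<in>UNIV. \<Sum>y\<in>UNIV. P x * (V x y * ln (V x y / out y)) - P x * V x y * ln (1 - e))"
      proof (intro sum_mono)
        fix x y
        show "P x * (V x y * ln (V x y / r y)) \<le> P x * (V x y * ln (V x y / out y)) - P x * V x y * ln (1 - e)"
        proof (cases "P x * V x y = 0")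
          case False
          then have pos: "P x > 0" "V x y > 0" using nn by (auto simp: less_le)
          then have "out y > 0" using out_ge[of x y] mult_pos_pos[of "P x" "V x y"] by linarith
          have "V x y / r y \<le> V x y / ((1 - e) * out y)"
            using pos e \<open>out y > 0\<close> r_pos[of y] by (intro divide_left_mono) (auto simp: r_def)
          then have "ln (V x y / r y) \<le> ln (V x y / ((1 - e) * out y))"
            using pos e \<open>out y > 0\<close> r_pos[of y] by (subst ln_le_cancel_iff) auto
          also have "\<dots> = ln (V x y / out y) - ln (1 - e)"
            using pos e \<open>out y > 0\<close> by (simp add: ln_div ln_mult)
          finally have "P x * V x y * ln (V x y / r y) \<le> P x * V x y * (ln (V x y / out y) - ln (1 - e))"
            using pos by (intro mult_left_mono) auto
          then show ?thesis by (simp add: algebra_simps)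
        qed auto
      qed
      also have "\<dots> = mutual_info P V * ln 2 - ln (1 - e)"
        unfolding mutual_info_ln out_def[symmetric]
        by (simp add: sum_subtractf sum_distrib_left[symmetric] sum_distrib_right[symmetric] sums)
      finally show ?thesis by simp
    qed
    \<comment> \<open>The value \<open>e = 0\<close> itself is excluded, since the output law may
      vanish somewhere; the bound is passed to the limit.\<close>
    have "((\<lambda>e. a + ln (1 - e)) \<longlongrightarrow> a + ln (1 - 0)) (at_right 0)"
      by (intro tendsto_intros) auto
    moreover have "eventually (\<lambda>e. a + ln (1 - e) \<le> mutual_info P V * ln 2) (at_right 0)"
      unfolding eventually_at_right_field using bound by (intro exI[of _ 1]) auto
    ultimately have "a \<le> mutual_info P V * ln 2"
      using tendsto_upperbound[of "\<lambda>e. a + ln (1 - e)" "a + ln (1 - 0)" "at_right 0"] by simp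
    then show ?thesis by (simp add: V_def pos_divide_le_eq)
  qed
  then have "a / ln 2 \<le> Inf ((\<lambda>q. mutual_info P (avg_chan W q)) ` distr_on UNIV)"
    using distr_on_uniform by (intro cINF_greatest) auto
  also have "\<dots> \<le> capacity W" by (rule Inf_mutual_info_le_capacity[OF W P])
  finally show False using a by (simp add: pos_divide_le_eq)
qed

section \<open>The source\<close>

text \<open>Only the point 0 is at issue. There \<open>- 2 * sqrt x\<close> and \<open>x * x\<close>
  squeeze the function; the lower bound comes from applying \<open>ln u \<le> u - 1\<close> to
  \<open>1 / sqrt x\<close>.\<close>

lemma continuous_on_mult_ln: "continuous_on {0..} (\<lambda>x::real. x * ln x)"
proof -
  have "((\<lambda>x::real. x * ln x) \<longlongrightarrow> 0) (at 0 within {0..})"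
  proof (rule tendsto_sandwich)
    have lower: "- 2 * sqrt x \<le> x * ln x" if "0 \<le> x" for x :: real
    proof (cases "x = 0")
      case False
      with that have "x > 0" by simp
      have "ln (1 / sqrt x) \<le> 1 / sqrt x - 1"
        using \<open>x > 0\<close> by (intro ln_le_minus_one) auto
      then have "- ln x \<le> 2 / sqrt x"
        using \<open>x > 0\<close> by (simp add: ln_div ln_sqrt)
      then have "x * (- ln x) \<le> x * (2 / sqrt x)"
        using \<open>x > 0\<close> by (intro mult_left_mono) auto
      also have "\<dots> = 2 * sqrt x"
        using \<open>x > 0\<close> by (simp add: field_simps)
      finally show ?thesis by simp
    qed simp
    show "eventually (\<lambda>x. - 2 * sqrt x \<le> x * ln x) (at 0 within {0..})"
      unfolding eventually_at_filter by (rule always_eventually) (use lower in auto)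
    have upper: "x * ln x \<le> x * x" if "0 \<le> x" for x :: real
      using that ln_le_minus_one[of x] by (cases "x = 0") (auto intro: mult_left_mono)
    show "eventually (\<lambda>x::real. x * ln x \<le> x * x) (at 0 within {0..})"
      unfolding eventually_at_filter by (rule always_eventually) (use upper in auto)
    have "((\<lambda>x. - 2 * sqrt x) \<longlongrightarrow> - 2 * sqrt 0) (at 0 within {0..})"
      by (intro tendsto_intros)
    then show "((\<lambda>x. - 2 * sqrt x) \<longlongrightarrow> 0) (at 0 within {0..})" by simp
    have "((\<lambda>x::real. x * x) \<longlongrightarrow> 0 * 0) (at 0 within {0..})"
      by (intro tendsto_intros)
    then show "((\<lambda>x::real. x * x) \<longlongrightarrow> 0) (at 0 within {0..})" by simp
  qed
  then have "continuous (at x within {0..}) (\<lambda>x. x * ln x)" if "0 \<le> x" for x :: real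
    by (cases "x = 0") (auto simp: continuous_within intro!: tendsto_intros)
  then show ?thesis by (simp add: continuous_on_eq_continuous_within)
qed

text \<open>Strong duality for the rate-distortion problem: \<open>j\<close> plays the role of the \<open>d\<close>-tilted information
  and \<open>l\<close> that of the slope of the rate-distortion curve. They are read off from a hyperplane that
  separates \<open>(R0 ln 2, PS, dl)\<close> from the closed convex set of all triples dominating
  \<open>(D (M \<parallel> PS \<times> M\<^sub>2), M\<^sub>1, E\<^sub>M dS)\<close> for a joint law \<open>M\<close> with marginals \<open>M\<^sub>1\<close>, \<open>M\<^sub>2\<close>.
  A vertical hyperplane, possible only when the distortion level is unattainable, is rescaled.\<close>
lemma rate_distortion_dual:
  fixes PS :: "'s::finite \<Rightarrow> real" and dS :: "'s \<Rightarrow> 's \<Rightarrow> real" and dl R0 :: real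
  assumes PS: "PS \<in> distr_on UNIV"
    and none: "\<And>V. \<lbrakk>V \<in> kernel_on UNIV UNIV;
        (\<Sum>s\<in>UNIV. \<Sum>sh\<in>UNIV. PS s * V s sh * dS s sh) \<le> dl\<rbrakk> \<Longrightarrow> R0 < mutual_info PS V"
  shows "\<exists>j l. 0 \<le> l \<and> (\<forall>sh. (\<Sum>s\<in>UNIV. PS s * exp (j s + l * (dl - dS s sh))) \<le> 1)
    \<and> R0 * ln 2 < (\<Sum>s\<in>UNIV. PS s * j s)"
proof -
  have PS_nn: "0 \<le> PS s" and PS_sum: "sum PS UNIV = 1" for s
    using PS by (auto simp: distr_on_def)
  \<comment> \<open>The first marginal is not fixed to \<open>PS\<close>: it is a coordinate of
    \<open>F\<close>, and its multiplier will become \<open>j\<close>. Absolute continuity with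
    respect to \<open>PS\<close> keeps the divergence finite and continuous.\<close>
  define MM where "MM = {M :: real^('s \<times> 's). (\<forall>s sh. 0 \<le> M $ (s, sh)) \<and>
      (\<forall>s sh. PS s = 0 \<longrightarrow> M $ (s, sh) = 0) \<and> (\<Sum>s\<in>UNIV. \<Sum>sh\<in>UNIV. M $ (s, sh)) = 1}"
  define m1 where "m1 M s = (\<Sum>sh\<in>UNIV. M $ (s, sh))" for M :: "real^('s \<times> 's)" and s
  define m2 where "m2 M sh = (\<Sum>s\<in>UNIV. M $ (s, sh))" for M :: "real^('s \<times> 's)" and sh
  define E where "E M = (\<Sum>s\<in>UNIV. \<Sum>sh\<in>UNIV. M $ (s, sh) * dS s sh)" for M :: "real^('s \<times> 's)"
  define \<Phi> where "\<Phi> M = (\<Sum>s\<in>UNIV. \<Sum>sh\<in>UNIV. M $ (s, sh) * ln (M $ (s, sh) / (PS s * m2 M sh)))"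
    for M :: "real^('s \<times> 's)"
  define F where "F M = (\<Phi> M, (\<chi> s. m1 M s) :: real^'s, E M)" for M
  \<comment> \<open>The cone of upward moves in divergence and distortion, with the marginal held
    fixed. As compact set plus closed cone, \<open>A\<close> will be closed.\<close>
  define K where "K = {c :: real \<times> (real^'s) \<times> real. 0 \<le> fst c \<and> fst (snd c) = 0 \<and> 0 \<le> snd (snd c)}"
  define A where "A = (\<Union>x\<in>F ` MM. \<Union>y\<in>K. {x + y})"
  have MM_nn: "0 \<le> M $ (s, sh)" and MM_zero: "PS s = 0 \<Longrightarrow> M $ (s, sh) = 0"
    if "M \<in> MM" for M s sh
    using that by (auto simp: MM_def)
  have m2_ge: "M $ (s, sh) \<le> m2 M sh" if "M \<in> MM" for M s sh
    unfolding m2_def by (rule member_le_sum) (auto simp: MM_nn[OF that])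
  have m2_nn: "0 \<le> m2 M sh" if "M \<in> MM" for M sh
    unfolding m2_def by (intro sum_nonneg) (simp add: MM_nn[OF that])
  have A_iff: "(p, w, e) \<in> A \<longleftrightarrow> (\<exists>M\<in>MM. \<Phi> M \<le> p \<and> (\<forall>s. w $ s = m1 M s) \<and> E M \<le> e)" for p w e
  proof
    assume "\<exists>M\<in>MM. \<Phi> M \<le> p \<and> (\<forall>s. w $ s = m1 M s) \<and> E M \<le> e"
    then obtain M where "M \<in> MM" "\<Phi> M \<le> p" "\<forall>s. w $ s = m1 M s" "E M \<le> e" by blast
    moreover from this have "(p, w, e) = F M + (p - \<Phi> M, 0, e - E M)"
      by (simp add: F_def vec_eq_iff)
    ultimately show "(p, w, e) \<in> A"
      unfolding A_def K_def by fastforce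
  qed (force simp: A_def F_def K_def)

  \<comment> \<open>Closedness: compact joint laws and continuity of the divergence\<close>
  have "bounded MM"
  proof (rule boundedI)
    fix M assume M: "M \<in> MM"
    have "norm M \<le> (\<Sum>p\<in>UNIV. \<bar>M $ p\<bar>)" by (rule norm_le_l1_cart)
    also have "\<dots> = (\<Sum>p\<in>UNIV \<times> UNIV. M $ p)"
      using MM_nn[OF M] by (auto intro!: sum.cong)
    also have "\<dots> = 1"
      using M by (simp add: MM_def sum.cartesian_product case_prod_beta)
    finally show "norm M \<le> 1" .
  qed
  moreover have "closed MM"
    unfolding MM_def by (intro closed_Collect_conj closed_Collect_all closed_Collect_le closed_Collect_eq
        closed_Collect_imp continuous_intros) auto
  ultimately have "compact MM" by (simp add: compact_eq_bounded_closed)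
  moreover have "continuous_on MM F"
  proof -
    define \<eta> where "\<eta> x = x * ln x" for x :: real
    \<comment> \<open>Splitting the logarithm leaves terms \<open>x * ln x\<close>, continuous up to
      0, and a part linear in \<open>M\<close>, as \<open>ln (PS s)\<close> is a constant. Cells of
      mass zero vanish on both sides.\<close>
    have \<Phi>_\<eta>: "\<Phi> M = (\<Sum>s\<in>UNIV. \<Sum>sh\<in>UNIV. \<eta> (M $ (s, sh))) - (\<Sum>sh\<in>UNIV. \<eta> (m2 M sh))
        - (\<Sum>s\<in>UNIV. \<Sum>sh\<in>UNIV. M $ (s, sh) * ln (PS s))" if M: "M \<in> MM" for M
    proof -
      have "M $ (s, sh) * ln (M $ (s, sh) / (PS s * m2 M sh))
          = \<eta> (M $ (s, sh)) - M $ (s, sh) * ln (m2 M sh) - M $ (s, sh) * ln (PS s)" for s sh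
      proof (cases "M $ (s, sh) = 0")
        case False
        then have "M $ (s, sh) > 0" "PS s > 0" "m2 M sh > 0"
          using MM_nn[OF M, of s sh] MM_zero[OF M, of s sh] m2_ge[OF M, of s sh] PS_nn[of s]
          by (auto simp: less_le)
        then show ?thesis by (simp add: ln_div ln_mult \<eta>_def algebra_simps)
      qed (simp add: \<eta>_def)
      moreover have "(\<Sum>sh\<in>UNIV. \<eta> (m2 M sh)) = (\<Sum>s\<in>UNIV. \<Sum>sh\<in>UNIV. M $ (s, sh) * ln (m2 M sh))"
        by (subst sum.swap) (simp add: \<eta>_def sum_distrib_right[symmetric] m2_def[symmetric])
      ultimately show ?thesis by (simp add: \<Phi>_def sum_subtractf)
    qed
    have \<eta>_cont: "continuous_on MM (\<lambda>M. \<eta> (g M))" if "continuous_on MM g" "\<And>M. M \<in> MM \<Longrightarrow> 0 \<le> g M" for g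
      unfolding \<eta>_def
      by (rule continuous_on_compose2[OF continuous_on_mult_ln that(1)]) (use that in auto)
    have "continuous_on MM (\<lambda>M. m2 M sh)" for sh
      unfolding m2_def by (intro continuous_intros)
    then have "continuous_on MM (\<lambda>M. (\<Sum>s\<in>UNIV. \<Sum>sh\<in>UNIV. \<eta> (M $ (s, sh))) - (\<Sum>sh\<in>UNIV. \<eta> (m2 M sh))
        - (\<Sum>s\<in>UNIV. \<Sum>sh\<in>UNIV. M $ (s, sh) * ln (PS s)))"
      by (intro continuous_intros \<eta>_cont) (auto simp: MM_nn m2_nn)
    then have "continuous_on MM \<Phi>"
      by (rule continuous_on_eq) (simp add: \<Phi>_\<eta>)
    then show ?thesis
      unfolding F_def m1_def E_def by (intro continuous_intros)
  qed
  ultimately have "compact (F ` MM)" by (rule compact_continuous_image[rotated])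
  moreover have "closed K"
    unfolding K_def by (intro closed_Collect_conj closed_Collect_le closed_Collect_eq continuous_intros)
  ultimately have "closed A"
    unfolding A_def by (rule compact_closed_sums)

  \<comment> \<open>Convexity of the set of dominating triples\<close>
  have "convex A"
  proof (rule convexI)
    fix x y and u v :: real
    assume xy: "x \<in> A" "y \<in> A" and uv: "0 \<le> u" "0 \<le> v" "u + v = 1"
    obtain p w e p' w' e' where x: "x = (p, w, e)" and y: "y = (p', w', e')"
      by (metis prod_cases3)
    obtain M N where M: "M \<in> MM" "\<Phi> M \<le> p" "\<And>s. w $ s = m1 M s" "E M \<le> e"
      and N: "N \<in> MM" "\<Phi> N \<le> p'" "\<And>s. w' $ s = m1 N s" "E N \<le> e'"
      using xy unfolding x y A_iff by blast
    define L where "L = u *\<^sub>R M + v *\<^sub>R N"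
    have L: "L $ (s, sh) = u * M $ (s, sh) + v * N $ (s, sh)" for s sh by (simp add: L_def)
    have "L \<in> MM"
      using M(1) N(1) uv by (auto simp: MM_def L sum.distrib sum_distrib_left[symmetric])
    moreover have "\<Phi> L \<le> u * p + v * p'"
    proof -
      have "\<Phi> L = (\<Sum>s\<in>UNIV. \<Sum>sh\<in>UNIV. (u * M $ (s, sh) + v * N $ (s, sh)) *
          ln ((u * M $ (s, sh) + v * N $ (s, sh)) / (u * (PS s * m2 M sh) + v * (PS s * m2 N sh))))"
        by (simp add: \<Phi>_def L m2_def sum.distrib sum_distrib_left algebra_simps)
      also have "\<dots> \<le> (\<Sum>s\<in>UNIV. \<Sum>sh\<in>UNIV. u * (M $ (s, sh) * ln (M $ (s, sh) / (PS s * m2 M sh)))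
          + v * (N $ (s, sh) * ln (N $ (s, sh) / (PS s * m2 N sh))))"
      proof (intro sum_mono mult_ln_div_convex)
        fix s sh
        show "PS s * m2 M sh = 0 \<longrightarrow> M $ (s, sh) = 0"
          using m2_ge[OF M(1), of s sh] MM_nn[OF M(1), of s sh] MM_zero[OF M(1), of s sh] by auto
        show "PS s * m2 N sh = 0 \<longrightarrow> N $ (s, sh) = 0"
          using m2_ge[OF N(1), of s sh] MM_nn[OF N(1), of s sh] MM_zero[OF N(1), of s sh] by auto
      qed (use M(1) N(1) uv in \<open>auto simp: MM_nn m2_nn PS_nn\<close>)
      also have "\<dots> = u * \<Phi> M + v * \<Phi> N"
        by (simp add: \<Phi>_def sum.distrib sum_distrib_left)
      also have "\<dots> \<le> u * p + v * p'"
        using M N uv by (intro add_mono mult_left_mono) auto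
      finally show ?thesis .
    qed
    moreover have "E L \<le> u * e + v * e'"
    proof -
      have "E L = u * E M + v * E N"
        by (simp add: E_def L sum.distrib sum_distrib_left algebra_simps)
      also have "\<dots> \<le> u * e + v * e'"
        using M N uv by (intro add_mono mult_left_mono) auto
      finally show ?thesis .
    qed
    moreover have "m1 L s = u * m1 M s + v * m1 N s" for s
      by (simp add: m1_def L sum.distrib sum_distrib_left)
    ultimately show "u *\<^sub>R x + v *\<^sub>R y \<in> A"
      using M(3) N(3) by (auto simp: x y A_iff)
  qed

  \<comment> \<open>The target triple lies outside\<close>
  have "(R0 * ln 2, (\<chi> s. PS s), dl) \<notin> A"
  proof
    assume "(R0 * ln 2, (\<chi> s. PS s), dl) \<in> A"
    then obtain M where M: "M \<in> MM" "\<Phi> M \<le> R0 * ln 2" "\<And>s. PS s = m1 M s" "E M \<le> dl"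
      unfolding A_iff by auto
    \<comment> \<open>The conditional law of \<open>M\<close> given the source letter, with the
      uniform law as default at letters of probability zero so that \<open>V\<close> is a
      kernel.\<close>
    define V where "V s sh = (if PS s = 0 then 1 / real CARD('s) else M $ (s, sh) / PS s)" for s sh
    have PV: "PS s * V s sh = M $ (s, sh)" for s sh
      using MM_zero[OF M(1)] by (simp add: V_def)
    have "(\<Sum>sh\<in>UNIV. V s sh) = 1" for s
      by (cases "PS s = 0") (auto simp: V_def sum_divide_distrib[symmetric] m1_def[symmetric] M(3)[symmetric])
    then have "V \<in> kernel_on UNIV UNIV"
      using MM_nn[OF M(1)] PS_nn by (auto simp: kernel_on_def distr_on_def V_def)
    moreover have "(\<Sum>s\<in>UNIV. \<Sum>sh\<in>UNIV. PS s * V s sh * dS s sh) \<le> dl"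
      using M(4) by (simp add: PV E_def)
    ultimately have "R0 < mutual_info PS V" by (rule none)
    moreover have "mutual_info PS V * ln 2 = \<Phi> M"
      unfolding mutual_info_ln \<Phi>_def
    proof (intro sum.cong refl)
      fix s sh
      show "PS s * (V s sh * ln (V s sh / (\<Sum>a'\<in>UNIV. PS a' * V a' sh)))
          = M $ (s, sh) * ln (M $ (s, sh) / (PS s * m2 M sh))"
        using MM_zero[OF M(1), of s sh]
        by (cases "PS s = 0") (auto simp: PV m2_def[symmetric] mult.assoc[symmetric], simp add: V_def)
    qed
    ultimately show False using M(2) by (smt (verit) ln_gt_zero mult_right_less_imp_less mult_strict_right_mono)
  qed

  \<comment> \<open>Separating hyperplane and its coefficients\<close>
  from separating_hyperplane_closed_point[OF \<open>convex A\<close> \<open>closed A\<close> this]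
  obtain a b where ab: "a \<bullet> (R0 * ln 2, (\<chi> s. PS s), dl) < b" "\<And>x. x \<in> A \<Longrightarrow> b < a \<bullet> x"
    by blast
  obtain \<alpha> w l where a: "a = (\<alpha>, w, l)" by (metis prod_cases3)
  have below: "\<alpha> * (R0 * ln 2) + (\<Sum>s\<in>UNIV. w $ s * PS s) + l * dl < b"
    using ab(1) by (simp add: a inner_vec_def)
  have above: "b < \<alpha> * p + (\<Sum>s\<in>UNIV. w $ s * m1 M s) + l * e" if "M \<in> MM" "\<Phi> M \<le> p" "E M \<le> e" for M p e
  proof -
    have "(p, (\<chi> s. m1 M s), e) \<in> A" using that by (auto simp: A_iff)
    from ab(2)[OF this] show ?thesis by (simp add: a inner_vec_def)
  qed
  \<comment> \<open>Some member of \<open>MM\<close>: the source with a constant reproduction,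
    \<open>undefined\<close> being just a fixed letter.\<close>
  define N :: "real^('s \<times> 's)" where "N = (\<chi> p. if snd p = undefined then PS (fst p) else 0)"
  have "N \<in> MM"
    using PS_nn PS_sum by (auto simp: MM_def N_def)
  \<comment> \<open>An affine function bounded below on the half line has no negative slope. Since
    \<open>above\<close> lets the divergence and distortion coordinates grow freely, this gives the
    signs of \<alpha> and \<open>l\<close>.\<close>
  have neg_absurd: False if "\<And>t. 0 \<le> t \<Longrightarrow> b < c + g * t" "g < 0" for c g :: real
  proof -
    have "0 \<le> (\<bar>b\<bar> + \<bar>c\<bar>) / (- g)" using that(2) by (intro divide_nonneg_pos) auto
    from that(1)[OF this] have "b < c + g * ((\<bar>b\<bar> + \<bar>c\<bar>) / (- g))" .
    also have "g * ((\<bar>b\<bar> + \<bar>c\<bar>) / (- g)) = - (\<bar>b\<bar> + \<bar>c\<bar>)" using that(2) by simp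
    finally show False by linarith
  qed
  have "0 \<le> \<alpha>"
  proof (rule ccontr)
    assume "\<not> 0 \<le> \<alpha>"
    then show False
      using above[OF \<open>N \<in> MM\<close>, of "\<Phi> N + t" "E N" for t]
      by (intro neg_absurd[of "\<alpha> * \<Phi> N + (\<Sum>s\<in>UNIV. w $ s * m1 N s) + l * E N" \<alpha>])
        (simp_all add: algebra_simps)
  qed
  have "0 \<le> l"
  proof (rule ccontr)
    assume "\<not> 0 \<le> l"
    then show False
      using above[OF \<open>N \<in> MM\<close>, of "\<Phi> N" "E N + t" for t]
      by (intro neg_absurd[of "\<alpha> * \<Phi> N + (\<Sum>s\<in>UNIV. w $ s * m1 N s) + l * E N" l])
        (simp_all add: algebra_simps)
  qed
  show ?thesis
  proof (cases "\<alpha> = 0")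
    case True
    \<comment> \<open>The vertical case: the divergence has dropped out, so the strict slack
      \<open>D\<close> can be scaled at will. The factor \<open>t\<close> brings the mean of
      \<open>j\<close> to one more than the absolute value of \<open>R0 * ln 2\<close>.\<close>
    define D where "D = b - (\<Sum>s\<in>UNIV. w $ s * PS s) - l * dl"
    have "D > 0" using below True by (simp add: D_def)
    define t where "t = (\<bar>R0 * ln 2\<bar> + 1) / D"
    have "t > 0" unfolding t_def using \<open>D > 0\<close> by (intro divide_pos_pos) auto
    have pt: "b < w $ s + l * dS s sh" if "PS s \<noteq> 0" for s sh
    proof -
      \<comment> \<open>Point masses turn the separation inequality into one for each pair of
        letters; it makes the exponents below nonpositive on the support of
        \<open>PS\<close>.\<close>
      define M :: "real^('s \<times> 's)" where "M = (\<chi> p. of_bool (fst p = s) * of_bool (snd p = sh))"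
      have M: "M $ (s', sh') = of_bool (s' = s) * of_bool (sh' = sh)" for s' sh'
        by (simp add: M_def)
      have pick: "(\<Sum>a\<in>UNIV. of_bool (a = c) * f a) = f c" for c :: 's and f :: "'s \<Rightarrow> real"
        using sum.delta[of UNIV c f] by (simp add: of_bool_def if_distrib[of "\<lambda>x. x * _"] cong: if_cong)
      have "M \<in> MM"
        using that pick[of _ "\<lambda>_. 1"] by (auto simp: MM_def M sum_distrib_left[symmetric])
      moreover have "m1 M s' = (if s' = s then 1 else 0)" for s'
        using pick[of sh "\<lambda>_. 1"] by (simp add: m1_def M sum_distrib_left[symmetric])
      moreover have "E M = dS s sh"
        by (simp add: E_def M mult.assoc sum_distrib_left[symmetric] pick)
      ultimately show ?thesis using above[of M "\<Phi> M" "E M"] True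
        by (simp add: if_distrib[of "\<lambda>x. _ * x"] cong: if_cong)
    qed
    show ?thesis
    proof (intro exI[of _ "\<lambda>s. t * (b - w $ s - l * dl)"] exI[of _ "t * l"] conjI allI)
      show "0 \<le> t * l" using \<open>t > 0\<close> \<open>0 \<le> l\<close> by simp
      fix sh
      have "PS s * exp (t * (b - w $ s - l * dl) + t * l * (dl - dS s sh)) \<le> PS s * 1" for s
      proof (cases "PS s = 0")
        case False
        have "t * (b - w $ s - l * dl) + t * l * (dl - dS s sh) = t * (b - (w $ s + l * dS s sh))"
          by (simp add: algebra_simps)
        also have "\<dots> \<le> 0" using pt[OF False, of sh] \<open>t > 0\<close> by (intro mult_nonneg_nonpos) auto
        finally show ?thesis using PS_nn by (intro mult_left_mono) auto
      qed simp
      then have "(\<Sum>s\<in>UNIV. PS s * exp (t * (b - w $ s - l * dl) + t * l * (dl - dS s sh))) \<le> (\<Sum>s\<in>UNIV. PS s)"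
        by (intro sum_mono) simp
      then show "(\<Sum>s\<in>UNIV. PS s * exp (t * (b - w $ s - l * dl) + t * l * (dl - dS s sh))) \<le> 1"
        by (simp add: PS_sum)
    next
      have "(\<Sum>s\<in>UNIV. PS s * (t * (b - w $ s - l * dl)))
          = t * ((b - l * dl) * sum PS UNIV - (\<Sum>s\<in>UNIV. w $ s * PS s))"
        by (simp add: sum_distrib_left sum_subtractf sum.distrib algebra_simps)
      also have "\<dots> = t * D" by (simp add: D_def PS_sum)
      also have "\<dots> = \<bar>R0 * ln 2\<bar> + 1" using \<open>D > 0\<close> by (simp add: t_def)
      finally show "R0 * ln 2 < (\<Sum>s\<in>UNIV. PS s * (t * (b - w $ s - l * dl)))" by linarith
    qed
  next
    case False
    with \<open>0 \<le> \<alpha>\<close> have "\<alpha> > 0" by simp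
    define w' l' b' where "w' s = w $ s / \<alpha>" and "l' = l / \<alpha>" and "b' = b / \<alpha>" for s
    have wlb: "w $ s = \<alpha> * w' s" "l = \<alpha> * l'" "b = \<alpha> * b'" for s
      using \<open>\<alpha> > 0\<close> by (auto simp: w'_def l'_def b'_def)
    have "\<alpha> * (R0 * ln 2 + (\<Sum>s\<in>UNIV. w' s * PS s) + l' * dl) < \<alpha> * b'"
      using below by (simp add: wlb distrib_left sum_distrib_left mult.assoc)
    then have below': "R0 * ln 2 + (\<Sum>s\<in>UNIV. w' s * PS s) + l' * dl < b'"
      using \<open>\<alpha> > 0\<close> by simp
    have above': "b' < \<Phi> M + (\<Sum>s\<in>UNIV. w' s * m1 M s) + l' * E M" if "M \<in> MM" for M
    proof -
      have "\<alpha> * b' < \<alpha> * (\<Phi> M + (\<Sum>s\<in>UNIV. w' s * m1 M s) + l' * E M)"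
        using above[OF that order_refl order_refl] by (simp add: wlb distrib_left sum_distrib_left mult.assoc)
      then show ?thesis using \<open>\<alpha> > 0\<close> by simp
    qed
    show ?thesis
    proof (intro exI[of _ "\<lambda>s. b' - w' s - l' * dl"] exI[of _ l'] conjI allI)
      show "0 \<le> l'" using \<open>\<alpha> > 0\<close> \<open>0 \<le> l\<close> by (simp add: l'_def)
      have "(\<Sum>s\<in>UNIV. PS s * (b' - w' s - l' * dl))
          = (b' - l' * dl) * sum PS UNIV - (\<Sum>s\<in>UNIV. w' s * PS s)"
        by (simp add: sum_distrib_left sum_subtractf sum.distrib algebra_simps)
      then show "R0 * ln 2 < (\<Sum>s\<in>UNIV. PS s * (b' - w' s - l' * dl))"
        using below' by (simp add: PS_sum)
    next
      fix sh
      \<comment> \<open>Gibbs variational principle for a fixed reproduction letter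
        \<open>sh\<close>: the second marginal is a point mass, and the source law tilted by
        \<open>exp (- w' s - l' * dS s sh)\<close> gives the functional in \<open>above'\<close> the
        value \<open>- ln z\<close>. Hence \<open>b' < - ln z\<close>, which is the required moment
        bound.\<close>
      define g where "g s = PS s * exp (- w' s - l' * dS s sh)" for s
      define z where "z = sum g UNIV"
      have g_nn: "0 \<le> g s" and g_zero: "PS s = 0 \<Longrightarrow> g s = 0" for s by (simp_all add: g_def PS_nn)
      have "z \<noteq> 0"
      proof
        assume "z = 0"
        then have "g s = 0" for s using g_nn by (simp add: z_def sum_nonneg_eq_0_iff)
        then have "PS s = 0" for s by (simp add: g_def)
        then show False using PS_sum by simp
      qed
      then have "z > 0" using g_nn by (simp add: z_def less_le sum_nonneg)
      define M where "M = (\<chi> p. if snd p = sh then g (fst p) / z else 0)"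
      have "M \<in> MM"
        using g_nn \<open>z > 0\<close> g_zero by (auto simp: MM_def M_def sum_divide_distrib[symmetric] z_def[symmetric])
      have m1M: "m1 M s = g s / z" for s by (simp add: m1_def M_def)
      have m2M: "m2 M sh = 1"
        using \<open>z > 0\<close> by (simp add: m2_def M_def sum_divide_distrib[symmetric] z_def[symmetric])
      have EM: "E M = (\<Sum>s\<in>UNIV. g s / z * dS s sh)"
        by (simp add: E_def M_def if_distrib[of "\<lambda>x. x * _"] cong: if_cong)
      have "\<Phi> M = (\<Sum>s\<in>UNIV. g s / z * ln (g s / z / PS s))"
        unfolding \<Phi>_def by (simp add: M_def m2M[unfolded M_def] if_distrib[of "\<lambda>x. x * _"] cong: if_cong)
      also have "\<dots> = (\<Sum>s\<in>UNIV. g s / z * (- w' s - l' * dS s sh - ln z))"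
      proof (intro sum.cong refl)
        fix s
        show "g s / z * ln (g s / z / PS s) = g s / z * (- w' s - l' * dS s sh - ln z)"
        proof (cases "PS s = 0")
          case False
          then have "g s / z / PS s = exp (- w' s - l' * dS s sh) / z" by (simp add: g_def)
          then show ?thesis using \<open>z > 0\<close> by (simp add: ln_div)
        qed (simp add: g_def)
      qed
      also have "\<dots> = - (\<Sum>s\<in>UNIV. w' s * m1 M s) - l' * E M - (\<Sum>s\<in>UNIV. g s / z) * ln z"
        by (simp add: m1M EM sum_distrib_left sum_distrib_right sum_subtractf sum_negf right_diff_distrib
            mult.commute mult.left_commute)
      also have "(\<Sum>s\<in>UNIV. g s / z) = 1"
        using \<open>z > 0\<close> by (simp add: sum_divide_distrib[symmetric] z_def[symmetric])
      finally have "b' < - ln z" using above'[OF \<open>M \<in> MM\<close>] by simp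
      then have "exp b' * z \<le> exp (- ln z) * z"
        using \<open>z > 0\<close> by (intro mult_right_mono) auto
      also have "\<dots> = 1" using \<open>z > 0\<close> by (simp add: exp_minus)
      finally have "exp b' * z \<le> 1" .
      moreover have "(\<Sum>s\<in>UNIV. PS s * exp (b' - w' s - l' * dl + l' * (dl - dS s sh))) = exp b' * z"
        unfolding z_def g_def sum_distrib_left
        by (intro sum.cong refl) (simp add: exp_add[symmetric] algebra_simps flip: exp_add)
      ultimately show "(\<Sum>s\<in>UNIV. PS s * exp (b' - w' s - l' * dl + l' * (dl - dS s sh))) \<le> 1" by simp
    qed
  qed
qed

section \<open>The strong converse\<close>

text \<open>A success is charged to one of three masses: \<open>B\<close> for an atypical source
  word, \<open>D\<close> for an atypical channel output, and otherwise \<open>G s t * r y\<close>.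
  In the last product the output no longer depends on the input, so decoding is blind guessing, and
  each guess \<open>t\<close> covers mass at most \<gamma>.\<close>

lemma one_shot_converse:
  fixes P B :: "'s \<Rightarrow> real" and QX :: "'s \<Rightarrow> 'x \<Rightarrow> real" and V D :: "'x \<Rightarrow> 'y \<Rightarrow> real"
    and QS :: "'y \<Rightarrow> 't \<Rightarrow> real" and G :: "'s \<Rightarrow> 't \<Rightarrow> real" and r :: "'y \<Rightarrow> real"
  assumes QX: "QX \<in> kernel_on S X" and QS: "QS \<in> kernel_on Y T"
    and V1: "\<And>x. x \<in> X \<Longrightarrow> (\<Sum>y\<in>Y. V x y) = 1" and v_nn: "\<And>x y. 0 \<le> V x y"
    and nn: "\<And>s. 0 \<le> P s" "\<And>s. 0 \<le> B s" "\<And>s t. 0 \<le> G s t" "\<And>y. 0 \<le> r y" "\<And>x y. 0 \<le> D x y"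
    and src: "\<And>s. s \<in> S \<Longrightarrow> P s \<le> B s \<or> (\<forall>t\<in>T. I s t \<longrightarrow> P s \<le> G s t)"
    and chan: "\<And>x y. x \<in> X \<Longrightarrow> y \<in> Y \<Longrightarrow> V x y \<le> r y + D x y"
    and sumP: "sum P S = 1" and sumB: "sum B S \<le> \<beta>" and sumG: "\<And>t. t \<in> T \<Longrightarrow> (\<Sum>s\<in>S. G s t) \<le> \<gamma>"
    and sumr: "sum r Y \<le> \<mu>" and sumD: "\<And>x. x \<in> X \<Longrightarrow> (\<Sum>y\<in>Y. D x y) \<le> \<delta>"
    and "0 \<le> \<gamma>"
  shows "(\<Sum>s\<in>S. \<Sum>x\<in>X. \<Sum>y\<in>Y. \<Sum>t\<in>T. (if I s t then 1 else 0) * P s * QX s x * V x y * QS y t)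
    \<le> \<beta> + \<gamma> * \<mu> + \<delta>"
proof -
  have k_nn: "0 \<le> QX s x" if "s \<in> S" for s x using QX that by (auto simp: kernel_on_def distr_on_def)
  have q_nn: "0 \<le> QS y t" if "y \<in> Y" for y t using QS that by (auto simp: kernel_on_def distr_on_def)
  have QX1: "(\<Sum>x\<in>X. QX s x) = 1" if "s \<in> S" for s using QX that by (auto simp: kernel_on_def distr_on_def)
  have QS1: "(\<Sum>t\<in>T. QS y t) = 1" if "y \<in> Y" for y using QS that by (auto simp: kernel_on_def distr_on_def)
  have pw: "(if I s t then 1 else 0) * P s * QX s x * V x y * QS y t
      \<le> B s * QX s x * V x y * QS y t + G s t * QX s x * r y * QS y t + P s * QX s x * D x y * QS y t"
    if st: "s \<in> S" "x \<in> X" "y \<in> Y" "t \<in> T" for s x y t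
  proof -
    have "(if I s t then 1 else 0) * P s * V x y \<le> B s * V x y + G s t * r y + P s * D x y"
    proof (cases "I s t")
      case True
      have "P s * V x y \<le> B s * V x y + G s t * r y + P s * D x y"
      proof (cases "P s \<le> B s")
        case True
        then have "P s * V x y \<le> B s * V x y" using v_nn st by (intro mult_right_mono) auto
        then show ?thesis using nn mult_nonneg_nonneg by (smt (verit))
      next
        case False
        then have "P s \<le> G s t" using src[of s] st \<open>I s t\<close> by blast
        then have "P s * r y \<le> G s t * r y" using nn by (intro mult_right_mono)
        moreover have "P s * V x y \<le> P s * (r y + D x y)"
          using chan st nn by (intro mult_left_mono)
        moreover have "0 \<le> B s * V x y" using nn v_nn st by simp
        ultimately show ?thesis by (simp add: distrib_left)
      qed
      then show ?thesis using True by simp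
    qed (use nn v_nn st in auto)
    then have "((if I s t then 1 else 0) * P s * V x y) * (QX s x * QS y t)
        \<le> (B s * V x y + G s t * r y + P s * D x y) * (QX s x * QS y t)"
      using k_nn q_nn st by (intro mult_right_mono) auto
    then show ?thesis by (simp only: distrib_left distrib_right mult_ac)
  qed
  have "(\<Sum>s\<in>S. \<Sum>x\<in>X. \<Sum>y\<in>Y. \<Sum>t\<in>T. (if I s t then 1 else 0) * P s * QX s x * V x y * QS y t)
    \<le> (\<Sum>s\<in>S. \<Sum>x\<in>X. \<Sum>y\<in>Y. \<Sum>t\<in>T. B s * QX s x * V x y * QS y t)
     + (\<Sum>s\<in>S. \<Sum>x\<in>X. \<Sum>y\<in>Y. \<Sum>t\<in>T. G s t * QX s x * r y * QS y t)
     + (\<Sum>s\<in>S. \<Sum>x\<in>X. \<Sum>y\<in>Y. \<Sum>t\<in>T. P s * QX s x * D x y * QS y t)"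
    unfolding sum.distrib[symmetric] by (intro sum_mono pw)
  also have "(\<Sum>s\<in>S. \<Sum>x\<in>X. \<Sum>y\<in>Y. \<Sum>t\<in>T. B s * QX s x * V x y * QS y t) = sum B S"
    by (simp add: sum_distrib_left[symmetric] QS1 V1 QX1)
  also have "\<dots> \<le> \<beta>" by (rule sumB)
  also have "(\<Sum>s\<in>S. \<Sum>x\<in>X. \<Sum>y\<in>Y. \<Sum>t\<in>T. G s t * QX s x * r y * QS y t) \<le> \<gamma> * \<mu>"
  proof -
    \<comment> \<open>With the channel replaced by \<open>r\<close>, the encoder sums out to 1, and
      for each reproduction \<open>t\<close> the sum over \<open>s\<close> can be done
      first.\<close>
    have "(\<Sum>s\<in>S. \<Sum>x\<in>X. \<Sum>y\<in>Y. \<Sum>t\<in>T. G s t * QX s x * r y * QS y t)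
        = (\<Sum>s\<in>S. \<Sum>x\<in>X. QX s x * (\<Sum>y\<in>Y. \<Sum>t\<in>T. G s t * r y * QS y t))"
      by (simp add: sum_distrib_left mult_ac)
    also have "\<dots> = (\<Sum>s\<in>S. \<Sum>y\<in>Y. \<Sum>t\<in>T. G s t * r y * QS y t)"
      by (simp add: sum_distrib_right[symmetric] QX1)
    also have "\<dots> = (\<Sum>y\<in>Y. \<Sum>s\<in>S. \<Sum>t\<in>T. G s t * r y * QS y t)"
      by (rule sum.swap)
    also have "\<dots> = (\<Sum>y\<in>Y. \<Sum>t\<in>T. \<Sum>s\<in>S. G s t * r y * QS y t)"
      by (intro sum.cong refl sum.swap)
    also have "\<dots> = (\<Sum>y\<in>Y. \<Sum>t\<in>T. (\<Sum>s\<in>S. G s t) * (r y * QS y t))"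
      by (simp add: sum_distrib_right mult.assoc)
    also have "\<dots> \<le> (\<Sum>y\<in>Y. \<Sum>t\<in>T. \<gamma> * (r y * QS y t))"
      using sumG nn q_nn by (intro sum_mono mult_right_mono) auto
    also have "\<dots> = \<gamma> * sum r Y"
      by (simp add: sum_distrib_left[symmetric] QS1)
    also have "\<dots> \<le> \<gamma> * \<mu>" using sumr \<open>0 \<le> \<gamma>\<close> by (rule mult_left_mono)
    finally show ?thesis .
  qed
  also have "(\<Sum>s\<in>S. \<Sum>x\<in>X. \<Sum>y\<in>Y. \<Sum>t\<in>T. P s * QX s x * D x y * QS y t)
      = (\<Sum>s\<in>S. \<Sum>x\<in>X. P s * QX s x * (\<Sum>y\<in>Y. D x y))"
    by (simp add: sum_distrib_left[symmetric] QS1)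
  also have "\<dots> \<le> (\<Sum>s\<in>S. \<Sum>x\<in>X. P s * QX s x * \<delta>)"
    using sumD nn k_nn by (intro sum_mono mult_left_mono) auto
  also have "\<dots> = \<delta>"
    by (simp add: sum_distrib_left[symmetric] sum_distrib_right[symmetric] QX1 sumP)
  finally show ?thesis by simp
qed

section \<open>The i.i.d. jammer, the averaged channel and total probabilities\<close>

definition iid_law :: "('a \<Rightarrow> real) \<Rightarrow> nat \<Rightarrow> 'a list \<Rightarrow> real" where
  "iid_law q n w = (if length w = n then \<Prod>i<n. q (w ! i) else 0)"

lemma iid_law_distr:
  fixes q :: "'a::finite \<Rightarrow> real"
  assumes "q \<in> distr_on UNIV"
  shows "iid_law q n \<in> distr_on (words n)"
proof -
  have "sum (iid_law q n) (words n) = (\<Sum>w\<in>words n. \<Prod>i<n. q (w ! i))"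
    by (intro sum.cong refl) (simp add: iid_law_def words_def)
  also have "\<dots> = 1"
    using sum_words_prod[of "\<lambda>_. q" n] distr_onD(3)[OF assms] by simp
  finally show ?thesis
    using distr_onD(1)[OF assms] by (auto simp: distr_on_def iid_law_def words_def intro!: prod_nonneg)
qed

lemma sum_iid_law_chan_n:
  assumes "x \<in> words n"
  shows "(\<Sum>th\<in>words n. iid_law q n th * chan_n W x th y) = (\<Prod>i<n. avg_chan W q (x ! i) (y ! i))"
proof -
  have "(\<Sum>th\<in>words n. iid_law q n th * chan_n W x th y)
      = (\<Sum>th\<in>words n. \<Prod>i<n. q (th ! i) * W (x ! i) (th ! i) (y ! i))"
    using assms by (intro sum.cong refl) (simp add: iid_law_def chan_n_def words_def prod.distrib)
  then show ?thesis
    using sum_words_prod[of "\<lambda>i t. q t * W (x ! i) t (y ! i)" n] by (simp add: avg_chan_def)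
qed

lemma sum_src_k:
  fixes PS :: "'s::finite \<Rightarrow> real"
  assumes "PS \<in> distr_on UNIV"
  shows "sum (src_k PS) (words k) = 1"
proof -
  have "sum (src_k PS) (words k) = (\<Sum>s\<in>words k. \<Prod>i<k. PS (s ! i))"
    by (intro sum.cong refl) (simp add: src_k_def words_def)
  then show ?thesis
    using sum_words_prod[of "\<lambda>_. PS" k] distr_onD(3)[OF assms] by simp
qed

lemma chan_n_kernel:
  fixes W :: "'x::finite \<Rightarrow> 't::finite \<Rightarrow> 'y::finite \<Rightarrow> real"
  assumes W: "\<And>x th. W x th \<in> distr_on UNIV" and x: "x \<in> words n"
  shows "(\<Sum>y\<in>words n. chan_n W x th y) = 1" "0 \<le> chan_n W x th y"
  using sum_words_prod[of "\<lambda>i. W (x ! i) (th ! i)" n] x distr_onD[OF W]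
  by (auto simp: chan_n_def words_def intro!: prod_nonneg)

lemma sum_code_law:
  fixes W :: "'x::finite \<Rightarrow> 't::finite \<Rightarrow> 'y::finite \<Rightarrow> real" and PS :: "'s::finite \<Rightarrow> real"
  assumes W: "\<And>x th. W x th \<in> distr_on UNIV" and PS: "PS \<in> distr_on UNIV"
    and code: "(QX, QS) \<in> codes k n" and q: "q \<in> distr_on (words n)"
  shows "(\<Sum>s\<in>words k. \<Sum>x\<in>words n. \<Sum>y\<in>words n. \<Sum>sh\<in>words k. \<Sum>th\<in>words n.
      q th * src_k PS s * QX s x * chan_n W x th y * QS y sh) = 1"
proof -
  have QX1: "(\<Sum>x\<in>words n. QX s x) = 1" if "s \<in> words k" for s
    using code that by (auto simp: codes_def kernel_on_def distr_on_def)
  have QS1: "(\<Sum>sh\<in>words k. QS y sh) = 1" if "y \<in> words n" for y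
    using code that by (auto simp: codes_def kernel_on_def distr_on_def)
  have "(\<Sum>y\<in>words n. \<Sum>sh\<in>words k. \<Sum>th\<in>words n. q th * src_k PS s * QX s x * chan_n W x th y * QS y sh)
      = src_k PS s * QX s x" if x: "x \<in> words n" for s x
  proof -
    have "(\<Sum>y\<in>words n. \<Sum>sh\<in>words k. \<Sum>th\<in>words n. q th * src_k PS s * QX s x * chan_n W x th y * QS y sh)
      = (\<Sum>y\<in>words n. \<Sum>th\<in>words n. q th * src_k PS s * QX s x * chan_n W x th y)"
      by (intro sum.cong refl, subst sum.swap) (simp add: sum_distrib_left[symmetric] QS1)
    also have "\<dots> = (\<Sum>th\<in>words n. q th * (src_k PS s * QX s x))"
      by (subst sum.swap) (simp add: sum_distrib_left[symmetric] chan_n_kernel(1)[OF W x] mult.assoc)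
    finally show ?thesis
      using distr_onD(3)[OF q] by (simp add: sum_distrib_right[symmetric])
  qed
  then show ?thesis
    by (simp add: sum_distrib_left[symmetric] QX1 sum_src_k[OF PS])
qed

lemma err_prob_bounds:
  fixes W :: "'x::finite \<Rightarrow> 't::finite \<Rightarrow> 'y::finite \<Rightarrow> real" and PS :: "'s::finite \<Rightarrow> real"
  assumes W: "\<And>x th. W x th \<in> distr_on UNIV" and PS: "PS \<in> distr_on UNIV"
    and code: "(QX, QS) \<in> codes k n" and q: "q \<in> distr_on (words n)"
  shows "0 \<le> err_prob PS W dS dl k n QX QS q" "err_prob PS W dS dl k n QX QS q \<le> 1"
proof -
  have nn: "0 \<le> q th * src_k PS s * QX s x * chan_n W x th y * QS y sh"
    if "s \<in> words k" "x \<in> words n" "y \<in> words n" for s x y sh th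
    using code that distr_onD(1)[OF q] distr_onD(1)[OF PS] chan_n_kernel(2)[OF W]
    by (auto simp: codes_def kernel_on_def distr_on_def src_k_def intro!: mult_nonneg_nonneg prod_nonneg)
  show "0 \<le> err_prob PS W dS dl k n QX QS q"
    unfolding err_prob_def using nn by (intro sum_nonneg) (auto simp: mult.assoc)
  have "err_prob PS W dS dl k n QX QS q \<le>
      (\<Sum>s\<in>words k. \<Sum>x\<in>words n. \<Sum>y\<in>words n. \<Sum>sh\<in>words k. \<Sum>th\<in>words n.
      q th * src_k PS s * QX s x * chan_n W x th y * QS y sh)"
    unfolding err_prob_def using nn by (intro sum_mono) (auto simp: mult.assoc)
  then show "err_prob PS W dS dl k n QX QS q \<le> 1"
    by (simp add: sum_code_law[OF W PS code q])
qed

text \<open>Success is the complement of error because the joint law has mass 1; the i.i.d. states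
  are then summed out letter by letter.\<close>

lemma success_prob_iid:
  fixes W :: "'x::finite \<Rightarrow> 't::finite \<Rightarrow> 'y::finite \<Rightarrow> real" and PS :: "'s::finite \<Rightarrow> real"
  assumes W: "\<And>x th. W x th \<in> distr_on UNIV" and PS: "PS \<in> distr_on UNIV"
    and code: "(QX, QS) \<in> codes k n" and q: "q \<in> distr_on UNIV"
  shows "1 - err_prob PS W dS dl k n QX QS (iid_law q n)
    = (\<Sum>s\<in>words k. \<Sum>x\<in>words n. \<Sum>y\<in>words n. \<Sum>sh\<in>words k. (if dist_k dS s sh \<le> dl then 1 else 0) *
        src_k PS s * QX s x * (\<Prod>i<n. avg_chan W q (x ! i) (y ! i)) * QS y sh)"
proof -
  have "(\<Sum>s\<in>words k. \<Sum>x\<in>words n. \<Sum>y\<in>words n. \<Sum>sh\<in>words k. \<Sum>th\<in>words n.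
        iid_law q n th * src_k PS s * QX s x * chan_n W x th y * QS y sh)
      - err_prob PS W dS dl k n QX QS (iid_law q n)
    = (\<Sum>s\<in>words k. \<Sum>x\<in>words n. \<Sum>y\<in>words n. \<Sum>sh\<in>words k. \<Sum>th\<in>words n.
        (if dist_k dS s sh \<le> dl then 1 else 0) * src_k PS s * QX s x * QS y sh *
        (iid_law q n th * chan_n W x th y))"
    unfolding err_prob_def sum_subtractf[symmetric]
    by (intro sum.cong refl) auto
  also have "\<dots> = (\<Sum>s\<in>words k. \<Sum>x\<in>words n. \<Sum>y\<in>words n. \<Sum>sh\<in>words k. (if dist_k dS s sh \<le> dl then 1 else 0) *
        src_k PS s * QX s x * (\<Prod>i<n. avg_chan W q (x ! i) (y ! i)) * QS y sh)"
    by (intro sum.cong refl) (simp add: sum_distrib_left[symmetric] sum_iid_law_chan_n)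
  finally show ?thesis
    by (simp only: sum_code_law[of W, OF W PS code iid_law_distr[OF q]])
qed

text \<open>With finitely many indices one small \<open>t\<close> serves all of them, and the
  largest moment is a common \<rho> below 1. For the channel the index is the input letter, so the
  exponent does not depend on the codeword.\<close>

lemma exists_exp_moment_bound:
  fixes p c :: "'b::finite \<Rightarrow> 'a::finite \<Rightarrow> real"
  assumes p: "\<And>b. p b \<in> distr_on UNIV" and neg: "\<And>b. (\<Sum>a\<in>UNIV. p b a * c b a) < 0"
  shows "\<exists>t>0. \<exists>\<rho><1. 0 \<le> \<rho> \<and> (\<forall>b. (\<Sum>a\<in>UNIV. p b a * exp (t * c b a)) \<le> \<rho>)"
proof -
  let ?m = "\<lambda>t b. \<Sum>a\<in>UNIV. p b a * exp (t * c b a)"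
  have "eventually (\<lambda>t. \<forall>b. ?m t b < 1) (at_right 0)"
    using exp_moment_less_1[OF p neg] by (simp add: eventually_all_finite)
  moreover have "eventually (\<lambda>t::real. 0 < t) (at_right 0)"
    by (simp add: eventually_at_filter)
  ultimately have "eventually (\<lambda>t. 0 < t \<and> (\<forall>b. ?m t b < 1)) (at_right 0)"
    by eventually_elim simp
  then obtain t where t: "0 < t" "\<And>b. ?m t b < 1"
    using eventually_happens[of _ "at_right (0::real)"] by (auto simp: trivial_limit_at_right_real)
  define \<rho> where "\<rho> = Max (range (?m t))"
  have le: "?m t b \<le> \<rho>" for b by (simp add: \<rho>_def)
  moreover have "\<rho> < 1" using t(2) by (simp add: \<rho>_def)
  moreover have "0 \<le> ?m t undefined" using distr_onD(1)[OF p] by (intro sum_nonneg) simp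
  then have "0 \<le> \<rho>" using le[of undefined] by linarith
  ultimately show ?thesis using t(1) by blast
qed

text \<open>The jammer law and both bases are fixed before \<open>k\<close>, \<open>n\<close> and
  the code, which is the uniformity needed for the limit. \<open>R0\<close> is in bits and
  \<open>a\<close> in nats, hence the factors \<open>ln 2\<close>. The hypothesis on
  \<open>R0\<close> speaks of each feasible kernel, so it makes sense even when there is
  none.\<close>

lemma strong_converse_bound:
  fixes W :: "'x::finite \<Rightarrow> 't::finite \<Rightarrow> 'y::finite \<Rightarrow> real" and PS :: "'s::finite \<Rightarrow> real"
    and dS :: "'s \<Rightarrow> 's \<Rightarrow> real" and dl a R0 :: real
  assumes W: "\<And>x th. W x th \<in> distr_on UNIV" and PS: "PS \<in> distr_on UNIV"
    and a: "capacity W * ln 2 < a"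
    and none: "\<And>V. \<lbrakk>V \<in> kernel_on UNIV UNIV;
        (\<Sum>s\<in>UNIV. \<Sum>sh\<in>UNIV. PS s * V s sh * dS s sh) \<le> dl\<rbrakk> \<Longrightarrow> R0 < mutual_info PS V"
  obtains q \<rho> \<rho>' where "q \<in> distr_on UNIV" "0 \<le> \<rho>" "\<rho> < 1" "0 \<le> \<rho>'" "\<rho>' < 1"
    "\<And>k n (QX :: 's list \<Rightarrow> 'x list \<Rightarrow> real) (QS :: 'y list \<Rightarrow> 's list \<Rightarrow> real). \<lbrakk>0 < k; (QX, QS) \<in> codes k n\<rbrakk> \<Longrightarrow>
      1 - (\<rho>' ^ k + exp (real n * a - real k * (R0 * ln 2)) + \<rho> ^ n)
      \<le> err_prob PS W dS dl k n QX QS (iid_law q n)"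
proof -
  obtain q r where q: "q \<in> distr_on UNIV" and r: "r \<in> distr_on UNIV" and r_pos: "\<And>y. 0 < r y"
    and div: "\<And>x. (\<Sum>y\<in>UNIV. avg_chan W q x y * ln (avg_chan W q x y / r y)) < a"
    using capacity_divergence_center[OF W a] by blast
  define V where "V = avg_chan W q"
  have V: "V x \<in> distr_on UNIV" for x
    using avg_chan_kernel[of W, OF W q] by (simp add: V_def kernel_on_def)
  note V_nn = distr_onD(1)[OF V] and V_sum = distr_onD(3)[OF V]
  define R1 where "R1 = R0 * ln 2"
  obtain j l where "0 \<le> l" and tilt: "\<And>sh. (\<Sum>s\<in>UNIV. PS s * exp (j s + l * (dl - dS s sh))) \<le> 1"
    and Ej: "R1 < (\<Sum>s\<in>UNIV. PS s * j s)"
    using rate_distortion_dual[OF PS none] unfolding R1_def by blast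
  have PS_nn: "0 \<le> PS s" for s using distr_onD(1)[OF PS] .
  have "(\<Sum>y\<in>UNIV. V x y * (ln (V x y / r y) - a)) < 0" for x
    using div[of x] V_sum[of x] by (simp add: V_def right_diff_distrib sum_subtractf sum_distrib_right[symmetric])
  from exists_exp_moment_bound[of V "\<lambda>x y. ln (V x y / r y) - a", OF V this]
  obtain t \<rho> where "t > 0" and \<rho>: "\<rho> < 1" "0 \<le> \<rho>"
    and mom: "\<And>x. (\<Sum>y\<in>UNIV. V x y * exp (t * (ln (V x y / r y) - a))) \<le> \<rho>"
    by blast
  have "(\<Sum>s\<in>UNIV. PS s * (R1 - j s)) < 0"
    using Ej distr_onD(3)[OF PS] by (simp add: right_diff_distrib sum_subtractf sum_distrib_right[symmetric])
  from exists_exp_moment_bound[of "\<lambda>_::unit. PS" "\<lambda>_ s. R1 - j s", OF PS this]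
  obtain t' \<rho>' where "t' > 0" and \<rho>': "\<rho>' < 1" "0 \<le> \<rho>'"
    and mom': "(\<Sum>s\<in>UNIV. PS s * exp (t' * (R1 - j s))) \<le> \<rho>'"
    by blast
  show thesis
  proof (rule that[OF q \<rho>(2,1) \<rho>'(2,1)])
    fix k n and QX :: "'s list \<Rightarrow> 'x list \<Rightarrow> real" and QS :: "'y list \<Rightarrow> 's list \<Rightarrow> real"
    assume "0 < k" and code: "(QX, QS) \<in> codes k n"
    \<comment> \<open>\<open>B\<close> and \<open>D\<close> carry the Chernoff weights for too
      little tilted information and too much information density. \<open>G\<close> is the tilted
      source measure scaled by \<open>exp (- real k * R1)\<close>, and \<open>rn\<close> the product
      law of \<open>r\<close> inflated by \<open>exp (real n * a)\<close>.\<close>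
    define Vn where "Vn x y = (\<Prod>i<n. V (x ! i) (y ! i))" for x y
    define B where "B s = (\<Prod>i<k. PS (s ! i) * exp (t' * (R1 - j (s ! i))))" for s
    define G where "G s sh = exp (- real k * R1) * (\<Prod>i<k. PS (s ! i) * exp (j (s ! i) + l * (dl - dS (s ! i) (sh ! i))))"
      for s sh
    define rn where "rn y = exp (real n * a) * (\<Prod>i<n. r (y ! i))" for y
    define D where "D x y = (\<Prod>i<n. V (x ! i) (y ! i) * exp (t * (ln (V (x ! i) (y ! i) / r (y ! i)) - a)))" for x y
    have "(\<Sum>s\<in>words k. \<Sum>x\<in>words n. \<Sum>y\<in>words n. \<Sum>sh\<in>words k.
        (if dist_k dS s sh \<le> dl then 1 else 0) * src_k PS s * QX s x * Vn x y * QS y sh)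
        \<le> \<rho>' ^ k + exp (- real k * R1) * exp (real n * a) + \<rho> ^ n"
    proof (rule one_shot_converse[where B = B and G = G and r = rn and D = D])
      show "QX \<in> kernel_on (words k) (words n)" "QS \<in> kernel_on (words n) (words k)"
        using code by (auto simp: codes_def)
      show "sum (src_k PS) (words k) = 1" by (rule sum_src_k[OF PS])
      show "sum B (words k) \<le> \<rho>' ^ k"
        unfolding B_def
        by (rule sum_words_prod_le_power[of "\<lambda>_ s. PS s * exp (t' * (R1 - j s))"]) (auto simp: PS_nn mom')
      show "(\<Sum>s\<in>words k. G s sh) \<le> exp (- real k * R1)" for sh
        using sum_words_prod_le_power[of "\<lambda>i s. PS s * exp (j s + l * (dl - dS s (sh ! i)))" k 1] PS_nn tilt
        by (simp add: G_def sum_distrib_left[symmetric])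
      show "sum rn (words n) \<le> exp (real n * a)"
        using sum_words_prod[of "\<lambda>_. r" n] distr_onD(3)[OF r]
        by (simp add: rn_def sum_distrib_left[symmetric])
      show "(\<Sum>y\<in>words n. D x y) \<le> \<rho> ^ n" for x
        unfolding D_def
        by (rule sum_words_prod_le_power[of "\<lambda>i y. V (x ! i) y * exp (t * (ln (V (x ! i) y / r y) - a))"])
          (auto simp: V_nn mom)
      show "0 \<le> src_k PS s" "0 \<le> B s" "0 \<le> G s sh" "0 \<le> rn y" "0 \<le> D x y" for s sh x y
        using r_pos by (auto simp: src_k_def B_def G_def rn_def D_def PS_nn V_nn less_imp_le intro!: prod_nonneg mult_nonneg_nonneg)
    next
      fix s :: "'s list" assume s: "s \<in> words k"
      define J where "J = (\<Sum>i<k. j (s ! i))"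
      have src: "src_k PS s = (\<Prod>i<k. PS (s ! i))" using s by (simp add: src_k_def words_def)
      have src_nn: "0 \<le> src_k PS s" by (simp add: src prod_nonneg PS_nn)
      show "src_k PS s \<le> B s \<or> (\<forall>sh\<in>words k. dist_k dS s sh \<le> dl \<longrightarrow> src_k PS s \<le> G s sh)"
      proof (cases "J \<le> real k * R1")
        case True
        have "B s = src_k PS s * exp (t' * (real k * R1 - J))"
          by (simp add: B_def src prod.distrib exp_sum[symmetric] sum_distrib_left[symmetric] sum_subtractf J_def)
        moreover have "1 \<le> exp (t' * (real k * R1 - J))" using True \<open>t' > 0\<close> by simp
        ultimately show ?thesis using src_nn by (simp add: mult_le_cancel_left1)
      next
        case False
        \<comment> \<open>Now \<open>J\<close> exceeds \<open>real k * R1\<close>, and the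
          distortion constraint with \<open>0 \<le> l\<close> makes the rest of the exponent
          nonnegative, so the tilt outweighs the scaling of \<open>G\<close>.\<close>
        have "src_k PS s \<le> G s sh" if "dist_k dS s sh \<le> dl" for sh
        proof -
          have "(\<Sum>i<k. dS (s ! i) (sh ! i)) \<le> real k * dl"
            using that s \<open>0 < k\<close> by (auto simp: dist_k_def words_def pos_divide_le_eq mult.commute)
          then have "0 \<le> l * (real k * dl - (\<Sum>i<k. dS (s ! i) (sh ! i)))" using \<open>0 \<le> l\<close> by simp
          then have ge: "1 \<le> exp (- real k * R1 + (J + l * (real k * dl - (\<Sum>i<k. dS (s ! i) (sh ! i)))))"
            using False by simp
          have "G s sh = exp (- real k * R1) * (src_k PS s * exp (J + l * (real k * dl - (\<Sum>i<k. dS (s ! i) (sh ! i)))))"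
            by (simp add: G_def src prod.distrib exp_sum[symmetric] sum_distrib_left[symmetric] sum_subtractf
                sum.distrib J_def)
          also have "\<dots> = src_k PS s * exp (- real k * R1 + (J + l * (real k * dl - (\<Sum>i<k. dS (s ! i) (sh ! i)))))"
            by (simp only: exp_add mult_ac)
          finally show ?thesis using src_nn ge by (simp add: mult_le_cancel_left1)
        qed
        then show ?thesis by blast
      qed
    next
      fix x :: "'x list" and y :: "'y list"
      show "Vn x y \<le> rn y + D x y"
      proof (cases "Vn x y = 0")
        \<comment> \<open>Treated apart, since the logarithms of likelihood ratios below require
          every factor to be positive.\<close>
        case True
        then show ?thesis using r_pos V_nn by (auto simp: rn_def D_def less_imp_le intro!: add_nonneg_nonneg prod_nonneg mult_nonneg_nonneg)
      next
        case False
        then have Vpos: "0 < V (x ! i) (y ! i)" if "i < n" for i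
          using that V_nn[of "x ! i" "y ! i"] by (auto simp: Vn_def less_le)
        define J where "J = (\<Sum>i<n. ln (V (x ! i) (y ! i) / r (y ! i)))"
        have Vn_J: "Vn x y = (\<Prod>i<n. r (y ! i)) * exp J"
          unfolding Vn_def J_def exp_sum[OF finite_lessThan] prod.distrib[symmetric]
          using Vpos r_pos by (intro prod.cong refl) (simp add: less_imp_neq[OF r_pos, symmetric])
        have D_J: "D x y = Vn x y * exp (t * (J - real n * a))"
          by (simp add: D_def Vn_def prod.distrib exp_sum[symmetric] sum_distrib_left[symmetric] sum_subtractf J_def)
        have "0 \<le> Vn x y" by (simp add: Vn_def prod_nonneg V_nn)
        have "0 \<le> (\<Prod>i<n. r (y ! i))" using r_pos by (intro prod_nonneg) (simp add: less_imp_le)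
        show ?thesis
        proof (cases "J \<le> real n * a")
          \<comment> \<open>Up to the threshold, changing the measure from \<open>Vn\<close> to the
            product law of \<open>r\<close> costs at most \<open>exp (real n * a)\<close>; beyond it
            the weight in \<open>D\<close> is at least 1.\<close>
          case True
          then have "Vn x y \<le> rn y"
            unfolding Vn_J rn_def using \<open>0 \<le> (\<Prod>i<n. r (y ! i))\<close> by (simp add: mult.commute mult_right_mono)
          then show ?thesis using \<open>0 \<le> Vn x y\<close> by (simp add: D_J add_increasing2)
        next
          case False
          then have "1 \<le> exp (t * (J - real n * a))" using \<open>t > 0\<close> by simp
          then have "Vn x y \<le> D x y" using \<open>0 \<le> Vn x y\<close> by (simp add: D_J mult_le_cancel_left1)
          moreover have "0 \<le> rn y" using \<open>0 \<le> (\<Prod>i<n. r (y ! i))\<close> by (simp add: rn_def)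
          ultimately show ?thesis by simp
        qed
      qed
    next
      show "(\<Sum>y\<in>words n. Vn x y) = 1" for x
        using sum_words_prod[of "\<lambda>i. V (x ! i)" n] V_sum by (simp add: Vn_def)
      show "0 \<le> Vn x y" for x y by (simp add: Vn_def prod_nonneg V_nn)
    qed simp
    then have "1 - err_prob PS W dS dl k n QX QS (iid_law q n)
        \<le> \<rho>' ^ k + exp (- real k * R1) * exp (real n * a) + \<rho> ^ n"
      unfolding Vn_def V_def by (simp only: success_prob_iid[of W, OF W PS code q, of dS dl])
    moreover have "exp (- real k * R1) * exp (real n * a) = exp (real n * a - real k * (R0 * ln 2))"
      by (simp add: R1_def flip: exp_add)
    ultimately show "1 - (\<rho>' ^ k + exp (real n * a - real k * (R0 * ln 2)) + \<rho> ^ n)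
      \<le> err_prob PS W dS dl k n QX QS (iid_law q n)"
      by linarith
  qed
qed

section \<open>From the uniform bound to both values of the game\<close>

lemma codes_nonempty:
  "\<exists>(QX :: 's::finite list \<Rightarrow> 'x::finite list \<Rightarrow> real) (QS :: 'y::finite list \<Rightarrow> 's list \<Rightarrow> real).
    (QX, QS) \<in> codes k n"
  using iid_law_distr[OF distr_on_uniform, where ?'a='x] iid_law_distr[OF distr_on_uniform, where ?'a='s]
  by (intro exI[of _ "\<lambda>_. iid_law (\<lambda>_. 1 / real CARD('x)) n"] exI[of _ "\<lambda>_. iid_law (\<lambda>_. 1 / real CARD('s)) k"])
    (auto simp: codes_def kernel_on_def)

text \<open>A jammer law that is good against every code is a candidate in the outer supremum of the
  lower value and in every inner supremum of the upper value. The rest is boundedness and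
  nonemptiness, without which \<open>Inf\<close> and \<open>Sup\<close> on the reals say
  nothing.\<close>

lemma values_between:
  fixes W :: "'x::finite \<Rightarrow> 't::finite \<Rightarrow> 'y::finite \<Rightarrow> real" and PS :: "'s::finite \<Rightarrow> real"
  assumes W: "\<And>x th. W x th \<in> distr_on UNIV" and PS: "PS \<in> distr_on UNIV"
    and q: "q \<in> distr_on (words n)"
    and lower: "\<And>(QX :: 's list \<Rightarrow> 'x list \<Rightarrow> real) (QS :: 'y list \<Rightarrow> 's list \<Rightarrow> real).
        (QX, QS) \<in> codes k n \<Longrightarrow> c \<le> err_prob PS W dS dl k n QX QS q"
  shows "c \<le> lower_val PS W dS dl k n" "lower_val PS W dS dl k n \<le> 1"
    "c \<le> upper_val PS W dS dl k n" "upper_val PS W dS dl k n \<le> 1"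
proof -
  note err = err_prob_bounds[of W, OF W PS]
  obtain QX0 :: "'s list \<Rightarrow> 'x list \<Rightarrow> real" and QS0 :: "'y list \<Rightarrow> 's list \<Rightarrow> real"
    where code0: "(QX0, QS0) \<in> codes k n" using codes_nonempty by blast
  let ?I = "\<lambda>q. Inf ((\<lambda>(QX, QS). err_prob PS W dS dl k n QX QS q) ` codes k n)"
  let ?S = "\<lambda>QX QS. Sup ((\<lambda>q. err_prob PS W dS dl k n QX QS q) ` distr_on (words n))"
  have "bdd_below ((\<lambda>(QX, QS). err_prob PS W dS dl k n QX QS q') ` codes k n)"
    if "q' \<in> distr_on (words n)" for q'
    using err(1)[OF _ that] by (intro bdd_belowI2[of _ 0]) auto
  then have I_le: "?I q' \<le> 1" if "q' \<in> distr_on (words n)" for q'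
    using err(2)[OF code0 that] that code0 by (intro cINF_lower2[where x = "(QX0, QS0)"]) auto
  have "c \<le> ?I q"
    using lower code0 by (intro cINF_greatest) auto
  also have "\<dots> \<le> lower_val PS W dS dl k n"
    unfolding lower_val_def using I_le q by (intro cSUP_upper bdd_aboveI2) auto
  finally show "c \<le> lower_val PS W dS dl k n" .
  show "lower_val PS W dS dl k n \<le> 1"
    unfolding lower_val_def using I_le q by (intro cSUP_least) auto
  have bdd: "bdd_above ((\<lambda>q. err_prob PS W dS dl k n QX QS q) ` distr_on (words n))"
    if "(QX, QS) \<in> codes k n" for QX QS
    using err(2)[OF that] by (intro bdd_aboveI2) auto
  have c_le: "c \<le> ?S QX QS" if "(QX, QS) \<in> codes k n" for QX QS
    using bdd[OF that] lower[OF that] q by (intro cSUP_upper2) auto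
  then show "c \<le> upper_val PS W dS dl k n"
    unfolding upper_val_def using code0 by (intro cINF_greatest) auto
  have "?S QX0 QS0 \<le> 1"
    using err(2)[OF code0] q by (intro cSUP_least) auto
  then show "upper_val PS W dS dl k n \<le> 1"
    unfolding upper_val_def using code0 c_le by (intro cINF_lower2[where x = "(QX0, QS0)"] bdd_belowI2[of _ c]) auto
qed

text \<open>The threshold is multiplied out, which avoids dividing by a rate-distortion value that
  may be zero.\<close>

theorem theorem2:
  fixes W :: "'x::finite \<Rightarrow> 't::finite \<Rightarrow> 'y::finite \<Rightarrow> real"
    and PS :: "'s::finite \<Rightarrow> real"
    and dS :: "'s \<Rightarrow> 's \<Rightarrow> real"
    and dl :: real
    and k n :: "nat \<Rightarrow> nat"
    and L :: real
  assumes W_stoch: "\<And>x th. W x th \<in> distr_on UNIV"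
    and PS_distr: "PS \<in> distr_on UNIV"
    and dS_nonneg: "\<And>s sh. 0 \<le> dS s sh"
    and dl_nonneg: "0 \<le> dl"
    and nonsym: "\<not> symmetrizable W"
    and k_pos: "\<And>j. 0 < k j" and n_pos: "\<And>j. 0 < n j"
    and k_inf: "filterlim k at_top sequentially"
    and n_inf: "filterlim n at_top sequentially"
    and ratio_lim: "(\<lambda>j. real (k j) / real (n j)) \<longlonglongrightarrow> L"
    and ratio_gt: "L * rate_distortion PS dS dl > capacity W"
  shows "(\<lambda>j. lower_val PS W dS dl (k j) (n j)) \<longlonglongrightarrow> 1
       \<and> (\<lambda>j. upper_val PS W dS dl (k j) (n j)) \<longlonglongrightarrow> 1"
proof -
  define \<V> where "\<V> = {V \<in> kernel_on UNIV UNIV. (\<Sum>s\<in>UNIV. \<Sum>sh\<in>UNIV. PS s * V s sh * dS s sh) \<le> dl}"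
  have "0 \<le> L"
    using ratio_lim by (rule LIMSEQ_le_const) auto
  moreover have C_nn: "0 \<le> capacity W" using W_stoch by (rule capacity_nonneg)
  then have "L \<noteq> 0" using ratio_gt by auto
  ultimately have "L > 0" by simp
  \<comment> \<open>The strict gap leaves room for an \<open>R0\<close> below all feasible mutual
    informations with \<open>L * R0\<close> still above capacity. The feasible set can be empty, as
    \<open>dS s s\<close> may be positive.\<close>
  have "\<exists>R0. (\<forall>V\<in>\<V>. R0 < mutual_info PS V) \<and> capacity W < L * R0"
  proof (cases "\<V> = {}")
    case True \<comment> \<open>here \<open>rate_distortion\<close> is the junk value \<open>Inf {}\<close>, and any \<open>R0\<close> will do\<close>
    then show ?thesis using \<open>L > 0\<close> by (intro exI[of _ "(capacity W + 1) / L"]) auto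
  next
    case False
    define R where "R = rate_distortion PS dS dl"
    have "bdd_below (mutual_info PS ` \<V>)"
      using mutual_info_bounds(1)[OF PS_distr] by (intro bdd_belowI2[of _ 0]) (auto simp: \<V>_def)
    then have R_le: "R \<le> mutual_info PS V" if "V \<in> \<V>" for V
      using that unfolding R_def rate_distortion_def \<V>_def[symmetric] by (intro cINF_lower) auto
    have "capacity W / L < R"
      using ratio_gt \<open>L > 0\<close> by (simp add: R_def field_simps)
    then obtain R0 where "capacity W / L < R0" "R0 < R" using dense by blast
    then show ?thesis
      using R_le \<open>L > 0\<close> by (intro exI[of _ R0]) (force simp: field_simps)
  qed
  then obtain R0 where none: "\<And>V. V \<in> \<V> \<Longrightarrow> R0 < mutual_info PS V" and R0: "capacity W < L * R0"
    by blast
  have "capacity W * ln 2 < L * R0 * ln 2" using R0 by simp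
  \<comment> \<open>The left inequality feeds the divergence bound; the right one makes the middle
    error term decay.\<close>
  then obtain a where a: "capacity W * ln 2 < a" "a < L * R0 * ln 2" using dense by blast
  obtain q \<rho> \<rho>' where q: "q \<in> distr_on UNIV" and \<rho>: "0 \<le> \<rho>" "\<rho> < 1" and \<rho>': "0 \<le> \<rho>'" "\<rho>' < 1"
    and bound: "\<And>k n (QX :: 's list \<Rightarrow> 'x list \<Rightarrow> real) (QS :: 'y list \<Rightarrow> 's list \<Rightarrow> real).
      \<lbrakk>0 < k; (QX, QS) \<in> codes k n\<rbrakk> \<Longrightarrow> 1 - (\<rho>' ^ k + exp (real n * a - real k * (R0 * ln 2)) + \<rho> ^ n)
      \<le> err_prob PS W dS dl k n QX QS (iid_law q n)"
    using strong_converse_bound[of W PS a dS dl R0] W_stoch PS_distr a(1) none unfolding \<V>_def by blast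
  define \<epsilon> where "\<epsilon> j = \<rho>' ^ k j + exp (real (n j) * a - real (k j) * (R0 * ln 2)) + \<rho> ^ n j" for j
  have "\<epsilon> \<longlonglongrightarrow> 0 + 0 + 0"
    unfolding \<epsilon>_def
  proof (intro tendsto_add)
    show "(\<lambda>j. \<rho>' ^ k j) \<longlonglongrightarrow> 0"
      using filterlim_compose[OF LIMSEQ_realpow_zero[OF \<rho>'] k_inf] .
    show "(\<lambda>j. \<rho> ^ n j) \<longlonglongrightarrow> 0"
      using filterlim_compose[OF LIMSEQ_realpow_zero[OF \<rho>] n_inf] .
    \<comment> \<open>The exponent is \<open>n j\<close> times a sequence converging to the negative
      number \<open>a - L * (R0 * ln 2)\<close>.\<close>
    have "(\<lambda>j. a - real (k j) / real (n j) * (R0 * ln 2)) \<longlonglongrightarrow> a - L * (R0 * ln 2)"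
      by (intro tendsto_intros ratio_lim)
    moreover have "filterlim (\<lambda>j. real (n j)) at_top sequentially"
      using filterlim_compose[OF filterlim_real_sequentially n_inf] .
    ultimately have "filterlim (\<lambda>j. (a - real (k j) / real (n j) * (R0 * ln 2)) * real (n j)) at_bot sequentially"
      using a(2) by (intro filterlim_tendsto_neg_mult_at_bot) auto
    moreover have "(a - real (k j) / real (n j) * (R0 * ln 2)) * real (n j)
        = real (n j) * a - real (k j) * (R0 * ln 2)" for j
      using n_pos[of j] by (simp add: field_simps)
    ultimately have "filterlim (\<lambda>j. real (n j) * a - real (k j) * (R0 * ln 2)) at_bot sequentially"
      by simp
    then show "(\<lambda>j. exp (real (n j) * a - real (k j) * (R0 * ln 2))) \<longlonglongrightarrow> 0"
      by (rule filterlim_compose[OF exp_at_bot])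
  qed
  then have lim: "(\<lambda>j. 1 - \<epsilon> j) \<longlonglongrightarrow> 1"
    using tendsto_diff[of "\<lambda>_. 1" 1 sequentially \<epsilon> 0] by simp
  have vals: "1 - \<epsilon> j \<le> lower_val PS W dS dl (k j) (n j)" "lower_val PS W dS dl (k j) (n j) \<le> 1"
    "1 - \<epsilon> j \<le> upper_val PS W dS dl (k j) (n j)" "upper_val PS W dS dl (k j) (n j) \<le> 1" for j
    using values_between[of W PS "iid_law q (n j)" "n j" "k j" "1 - \<epsilon> j" dS dl]
      W_stoch PS_distr iid_law_distr[OF q] bound[OF k_pos] by (auto simp: \<epsilon>_def)
  show ?thesis
  proof
    show "(\<lambda>j. lower_val PS W dS dl (k j) (n j)) \<longlonglongrightarrow> 1"
      by (rule tendsto_sandwich[OF _ _ lim tendsto_const]) (auto intro!: always_eventually vals(1,2))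
    show "(\<lambda>j. upper_val PS W dS dl (k j) (n j)) \<longlonglongrightarrow> 1"
      by (rule tendsto_sandwich[OF _ _ lim tendsto_const]) (auto intro!: always_eventually vals(3,4))
  qed
qed

end
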